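(* Let $r(S_4)$ be the complex representation ring of the symmetric group $S_4$, with basis $\{1,V_\psi,V_{\rho_1},V_{\rho_2},V_{\rho_3}\}$. Let $M_{1,1}$ be the $\mathbb{Z}_+$-module of rank $1$ over $r(S_4)$ defined by $V_\psi\mapsto 1$, $V_{\rho_1}\mapsto 2$, $V_{\rho_2}\mapsto 3$, $V_{\rho_3}\mapsto 3$. Then any irreducible based module of rank $1$ over $r(S_4)$ is equivalent to $M_{1,1}$.
   Context: The ring $r(S_4)$ is the Grothendieck ring of finite-dimensional complex representations of $S_4$. It is commutative and free over $\mathbb{Z}$ with basis $\{1,V_\psi,V_{\rho_1},V_{\rho_2},V_{\rho_3}\}$, the classes of the irreducible representations: trivial, sign, the 2-dimensional one, the 3-dimensional standard one, and $V_{\rho_3}=V_\psi V_{\rho_2}$. The products are determined by $V_\psi^2=1$, $V_\psi V_{\rho_1}=V_{\rho_1}$, $V_\psi V_{\rho_2}=V_{\rho_3}$, $V_{\rho_1}^2=1+V_\psi+V_{\rho_1}$, $V_{\rho_1}V_{\rho_2}=V_{\rho_2}+V_{\rho_3}$, $V_{\rho_2}^2=1+V_{\rho_1}+V_{\rho_2}+V_{\rho_3}$. All basis elements are self-dual. A $\mathbb{Z}_+$-module over $r(S_4)$ is an $r(S_4)$-module $M$ (with $1$ acting as identity) together with a fixed $\mathbb{Z}$-basis in which each basis element of $r(S_4)$ acts by a matrix with non-negative integer entries. Its rank is the size of the basis. It is a based module if, moreover, the matrix of each basis element of $r(S_4)$ is symmetric (this is the general condition $a_{il}^k=a_{i^*k}^l$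 on structure constants $b_i m_l=\sum_k a_{il}^k m_k$, since here $i^*=i$). It is irreducible if it is nonzero and no nonempty proper subset of the fixed basis spans an $r(S_4)$-submodule. Two $\mathbb{Z}_+$-modules are equivalent if some bijection between their fixed bases induces an isomorphism of $r(S_4)$-modules, i.e. the representing matrices are simultaneously conjugate by a permutation matrix. *)

theory Defs
  imports
    "HOL-Algebra.Sym_Groups"
    "HOL-Algebra.Module"
    "HOL-Library.FuncSet"
    "Jordan_Normal_Form.Matrix"
    Complex_Main
begin

section \<open>Complex matrix representations of a group\<close>

type_synonym 'g rep = "'g \<Rightarrow> complex mat"

text \<open>A homomorphism from \<open>G\<close> to the invertible \<open>d \<times> d\<close> matrices (invertibility is automatic).
  The degree \<open>d\<close> may be zero; the values of \<open>\<rho>\<close> outside \<open>carrier G\<close> are irrelevant.\<close>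

definition representation :: "('g, 'c) monoid_scheme \<Rightarrow> nat \<Rightarrow> 'g rep \<Rightarrow> bool" where
  "representation G d \<rho> \<longleftrightarrow>
     (\<forall>g\<in>carrier G. \<rho> g \<in> carrier_mat d d) \<and>
     \<rho> \<one>\<^bsub>G\<^esub> = 1\<^sub>m d \<and>
     (\<forall>g\<in>carrier G. \<forall>h\<in>carrier G. \<rho> (g \<otimes>\<^bsub>G\<^esub> h) = \<rho> g * \<rho> h)"

definition reps :: "('g, 'c) monoid_scheme \<Rightarrow> 'g rep set" where
  "reps G = {\<rho>. \<exists>d. representation G d \<rho>}"

definition rep_iso :: "('g, 'c) monoid_scheme \<Rightarrow> 'g rep \<Rightarrow> 'g rep \<Rightarrow> bool" where
  "rep_iso G \<rho> \<sigma> \<longleftrightarrow>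
     (\<exists>d P. representation G d \<rho> \<and> representation G d \<sigma> \<and>
        P \<in> carrier_mat d d \<and> invertible_mat P \<and> (\<forall>g\<in>carrier G. P * \<rho> g = \<sigma> g * P))"

definition zero_rep :: "'g rep" where
  "zero_rep = (\<lambda>g. 1\<^sub>m 0)"

definition trivial_rep :: "'g rep" where
  "trivial_rep = (\<lambda>g. 1\<^sub>m 1)"

definition dsum_rep :: "'g rep \<Rightarrow> 'g rep \<Rightarrow> 'g rep" where
  "dsum_rep \<rho> \<sigma> = (\<lambda>g. four_block_mat
     (\<rho> g) (0\<^sub>m (dim_row (\<rho> g)) (dim_col (\<sigma> g)))
     (0\<^sub>m (dim_row (\<sigma> g)) (dim_col (\<rho> g))) (\<sigma> g))"

definition kronecker :: "'a :: times mat \<Rightarrow> 'a mat \<Rightarrow> 'a mat" where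
  "kronecker A B = mat (dim_row A * dim_row B) (dim_col A * dim_col B)
     (\<lambda>(i, j). A $$ (i div dim_row B, j div dim_col B) * B $$ (i mod dim_row B, j mod dim_col B))"

definition tensor_rep :: "'g rep \<Rightarrow> 'g rep \<Rightarrow> 'g rep" where
  "tensor_rep \<rho> \<sigma> = (\<lambda>g. kronecker (\<rho> g) (\<sigma> g))"

section \<open>The Grothendieck ring of complex representations\<close>

text \<open>A pair \<open>(\<rho>, \<sigma>)\<close> stands for the formal difference \<open>[\<rho>] - [\<sigma>]\<close> of isomorphism classes.\<close>

definition virtual_eq :: "('g, 'c) monoid_scheme \<Rightarrow> (('g rep \<times> 'g rep) \<times> ('g rep \<times> 'g rep)) set" where
  "virtual_eq G = {((\<rho>, \<sigma>), (\<rho>', \<sigma>')).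
     \<rho> \<in> reps G \<and> \<sigma> \<in> reps G \<and> \<rho>' \<in> reps G \<and> \<sigma>' \<in> reps G \<and>
     (\<exists>\<tau>\<in>reps G. rep_iso G (dsum_rep (dsum_rep \<rho> \<sigma>') \<tau>) (dsum_rep (dsum_rep \<rho>' \<sigma>) \<tau>))}"

type_synonym 'g virtual = "('g rep \<times> 'g rep) set"

definition rep_class :: "('g, 'c) monoid_scheme \<Rightarrow> 'g rep \<Rightarrow> 'g virtual" where
  "rep_class G \<rho> = virtual_eq G `` {(\<rho>, zero_rep)}"

definition representation_ring :: "('g, 'c) monoid_scheme \<Rightarrow> 'g virtual ring" where
  "representation_ring G = \<lparr>
     carrier = (reps G \<times> reps G) // virtual_eq G,
     mult = (\<lambda>A B. virtual_eq G ``
       {(dsum_rep (tensor_rep \<rho> \<rho>') (tensor_rep \<sigma> \<sigma>'), dsum_rep (tensor_rep \<rho> \<sigma>') (tensor_rep \<sigma> \<rho>'))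
         | \<rho> \<sigma> \<rho>' \<sigma>'. (\<rho>, \<sigma>) \<in> A \<and> (\<rho>', \<sigma>') \<in> B}),
     one = rep_class G trivial_rep,
     zero = rep_class G zero_rep,
     add = (\<lambda>A B. virtual_eq G ``
       {(dsum_rep \<rho> \<rho>', dsum_rep \<sigma> \<sigma>') | \<rho> \<sigma> \<rho>' \<sigma>'. (\<rho>, \<sigma>) \<in> A \<and> (\<rho>', \<sigma>') \<in> B})\<rparr>"

section \<open>The ring r(S_4) and its basis of irreducible classes\<close>

definition sign_rep :: "(nat \<Rightarrow> nat) rep" where
  "sign_rep p = mat 1 1 (\<lambda>_. of_int (sign p))"

text \<open>The permutation action on the vectors of coordinate sum zero, in the basis
  \<open>e\<^sub>1 - e\<^sub>4\<close>, \<open>e\<^sub>2 - e\<^sub>4\<close>, \<open>e\<^sub>3 - e\<^sub>4\<close>. Matrix indices start at 0, points at 1.\<close>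

definition standard_rep :: "(nat \<Rightarrow> nat) rep" where
  "standard_rep p = mat 3 3 (\<lambda>(i, j). of_bool (p (Suc j) = Suc i) - of_bool (p 4 = Suc i))"

text \<open>\<open>S\<^sub>4\<close> permutes the three partitions of \<open>{1, 2, 3, 4}\<close> into two pairs. Number by \<open>k \<in> {1, 2, 3}\<close>
  the partition in which \<open>k\<close> is paired with \<open>4\<close>; its image is the one in which \<open>p k\<close> is paired with
  \<open>p 4\<close>. If neither of these is \<open>4\<close>, then \<open>4\<close> is paired with the remaining point, and
  \<open>1 + 2 + 3 = 6\<close>.\<close>

definition pairing_perm :: "(nat \<Rightarrow> nat) \<Rightarrow> nat \<Rightarrow> nat" where
  "pairing_perm p k = (if p k = 4 then p 4 else if p 4 = 4 then p k else 6 - p k - p 4)"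

text \<open>The 2-dimensional irreducible representation: the standard representation of \<open>S\<^sub>3\<close>,
  in the basis \<open>e\<^sub>1 - e\<^sub>3\<close>, \<open>e\<^sub>2 - e\<^sub>3\<close>, pulled back along this action.\<close>

definition two_dim_rep :: "(nat \<Rightarrow> nat) rep" where
  "two_dim_rep p = mat 2 2 (\<lambda>(i, j).
     of_bool (pairing_perm p (Suc j) = Suc i) - of_bool (pairing_perm p 3 = Suc i))"

definition rS4 :: "(nat \<Rightarrow> nat) virtual ring" where
  "rS4 = representation_ring (sym_group 4)"

definition V_psi :: "(nat \<Rightarrow> nat) virtual" where
  "V_psi = rep_class (sym_group 4) sign_rep"

definition V_rho1 :: "(nat \<Rightarrow> nat) virtual" where
  "V_rho1 = rep_class (sym_group 4) two_dim_rep"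

definition V_rho2 :: "(nat \<Rightarrow> nat) virtual" where
  "V_rho2 = rep_class (sym_group 4) standard_rep"

definition V_rho3 :: "(nat \<Rightarrow> nat) virtual" where
  "V_rho3 = rep_class (sym_group 4) (tensor_rep sign_rep standard_rep)"

definition rS4_basis :: "(nat \<Rightarrow> nat) virtual set" where
  "rS4_basis = {\<one>\<^bsub>rS4\<^esub>, V_psi, V_rho1, V_rho2, V_rho3}"

section \<open>Bases over the integers\<close>

definition zcomb :: "('a, 'c) ring_scheme \<Rightarrow> 'a set \<Rightarrow> ('a \<Rightarrow> int) \<Rightarrow> 'a" where
  "zcomb M X c = (\<Oplus>\<^bsub>M\<^esub>x\<in>X. [c x] \<cdot>\<^bsub>M\<^esub> x)"

definition zspan :: "('a, 'c) ring_scheme \<Rightarrow> 'a set \<Rightarrow> 'a set" where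
  "zspan M X = {zcomb M X c | c. True}"

text \<open>Coefficient families are taken in \<open>X \<rightarrow>\<^sub>E UNIV\<close> so that uniqueness only concerns their
  values on \<open>X\<close>.\<close>

definition z_basis :: "('a, 'c) ring_scheme \<Rightarrow> 'a set \<Rightarrow> bool" where
  "z_basis M X \<longleftrightarrow> finite X \<and> X \<subseteq> carrier M \<and>
     (\<forall>m\<in>carrier M. \<exists>!c. c \<in> X \<rightarrow>\<^sub>E UNIV \<and> m = zcomb M X c)"

definition zcoord :: "('a, 'c) ring_scheme \<Rightarrow> 'a set \<Rightarrow> 'a \<Rightarrow> 'a \<Rightarrow> int" where
  "zcoord M X m = (THE c. c \<in> X \<rightarrow>\<^sub>E UNIV \<and> m = zcomb M X c)"

section \<open>Nonnegative modules over a ring with a fixed basis\<close>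

text \<open>\<open>B\<close> is the fixed basis of \<open>R\<close> and \<open>X\<close> the fixed basis of \<open>M\<close>. The integer
  \<open>struct_const M X b l k\<close> is the coefficient of \<open>k\<close> in \<open>b l\<close>, that is, the entry in row \<open>k\<close>
  and column \<open>l\<close> of the matrix of \<open>b\<close>.\<close>

definition struct_const :: "('r, 'm, 'c) module_scheme \<Rightarrow> 'm set \<Rightarrow> 'r \<Rightarrow> 'm \<Rightarrow> 'm \<Rightarrow> int" where
  "struct_const M X b l k = zcoord M X (b \<odot>\<^bsub>M\<^esub> l) k"

definition zplus_module ::
  "('r, 'd) ring_scheme \<Rightarrow> 'r set \<Rightarrow> ('r, 'm, 'c) module_scheme \<Rightarrow> 'm set \<Rightarrow> bool" where
  "zplus_module R B M X \<longleftrightarrow> module R M \<and> z_basis M X \<and>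
     (\<forall>b\<in>B. \<forall>l\<in>X. \<forall>k\<in>X. struct_const M X b l k \<ge> 0)"

text \<open>This is the notion of a based module for a basis \<open>B\<close> all of whose elements are self-dual,
  as is the case for \<open>r(S\<^sub>4)\<close>.\<close>

definition based_module ::
  "('r, 'd) ring_scheme \<Rightarrow> 'r set \<Rightarrow> ('r, 'm, 'c) module_scheme \<Rightarrow> 'm set \<Rightarrow> bool" where
  "based_module R B M X \<longleftrightarrow> zplus_module R B M X \<and>
     (\<forall>b\<in>B. \<forall>l\<in>X. \<forall>k\<in>X. struct_const M X b l k = struct_const M X b k l)"

definition irreducible_zplus_module ::
  "('r, 'd) ring_scheme \<Rightarrow> 'r set \<Rightarrow> ('r, 'm, 'c) module_scheme \<Rightarrow> 'm set \<Rightarrow> bool" where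
  "irreducible_zplus_module R B M X \<longleftrightarrow> zplus_module R B M X \<and> carrier M \<noteq> {\<zero>\<^bsub>M\<^esub>} \<and>
     \<not> (\<exists>Y. Y \<noteq> {} \<and> Y \<subset> X \<and> submodule (zspan M Y) R M)"

definition equivalent_zplus_modules ::
  "('r, 'd) ring_scheme \<Rightarrow> 'r set \<Rightarrow> ('r, 'm, 'c) module_scheme \<Rightarrow> 'm set \<Rightarrow>
    ('r, 'n, 'e) module_scheme \<Rightarrow> 'n set \<Rightarrow> bool" where
  "equivalent_zplus_modules R B M X N Y \<longleftrightarrow>
     zplus_module R B M X \<and> zplus_module R B N Y \<and>
     (\<exists>f. bij_betw f (carrier M) (carrier N) \<and> bij_betw f X Y \<and>
        (\<forall>m\<in>carrier M. \<forall>n\<in>carrier M. f (m \<oplus>\<^bsub>M\<^esub> n) = f m \<oplus>\<^bsub>N\<^esub> f n) \<and>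
        (\<forall>r\<in>carrier R. \<forall>m\<in>carrier M. f (r \<odot>\<^bsub>M\<^esub> m) = r \<odot>\<^bsub>N\<^esub> f m))"

section \<open>The module of rank one\<close>

text \<open>The underlying group is that of the integers, with fixed basis \<open>{1}\<close>. The action is the
  additive extension of \<open>1 \<mapsto> 1\<close>, \<open>V_psi \<mapsto> 1\<close>, \<open>V_rho1 \<mapsto> 2\<close>, \<open>V_rho2 \<mapsto> 3\<close>, \<open>V_rho3 \<mapsto> 3\<close>.
  The fields \<open>mult\<close> and \<open>one\<close> of the record play no role for modules.\<close>

definition M11 :: "((nat \<Rightarrow> nat) virtual, int) module" where
  "M11 = \<lparr>carrier = UNIV, mult = (*), one = 1, zero = 0, add = (+),
     smult = (\<lambda>r n.
       (let c = zcoord rS4 rS4_basis r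
        in c \<one>\<^bsub>rS4\<^esub> * 1 + c V_psi * 1 + c V_rho1 * 2 + c V_rho2 * 3 + c V_rho3 * 3) * n)\<rparr>"

definition M11_basis :: "int set" where
  "M11_basis = {1}"

end

theory Submission
  imports Defs "Jordan_Normal_Form.Determinant"
begin

text \<open>On a module of rank one with basis \<open>{x}\<close> every \<open>r\<close> acts by an integer \<open>\<phi> r\<close>, and \<open>\<phi>\<close> is a ring
  homomorphism that is nonnegative on the basis. From \<open>V_psi\<^sup>2 = 1\<close>, \<open>V_rho1\<^sup>2 = 1 + V_psi + V_rho1\<close> and
  \<open>V_rho2\<^sup>2 = 1 + V_rho1 + V_rho2 + V_psi V_rho2\<close> nonnegativity forces the values \<open>1, 2, 3\<close>, so \<open>\<phi>\<close> is
  the dimension.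

  These relations, and the fact that the five classes form a basis, hold in the ring of actual
  representations because a virtual representation is determined by its character. To see this
  without Maschke's theorem or Schur's lemma, start from the identity
  \<open>\<Sum>\<^sub>i d\<^sub>i \<chi>\<^sub>i(g) = |G| [g = 1]\<close>, which is read off the character table. It says that
  the square matrix of all coefficients has a left inverse; the right inverse property is Schur
  orthogonality, which yields matrix units acting on every representation. The image of the
  matrix unit \<open>(0, 0)\<close> of the \<open>i\<close>-th block has as dimension the multiplicity of the \<open>i\<close>-th
  irreducible, and isomorphisms between these images assemble to intertwiners.\<close>

section \<open>Sums, traces and idempotents of matrices\<close>

text \<open>Equality in the ring is stable isomorphism of explicit matrix representations, so even
  the additive group laws call for intertwiners. Once isomorphism amounts to equality of characters,
  the auxiliary summand in \<open>virtual_eq\<close> cancels and every identity of the ring is a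
  pointwise identity of complex functions.

  A second obstacle is integrality: decomposing a character by traces gives only complex
  coefficients. Each of them is the trace of an idempotent matrix, hence a rank, and this is what
  puts the coordinates in the integers.

  The coefficient matrix is square because the regular character at the identity gives the sum of
  the squared degrees; for the five representations here this is 1 + 1 + 4 + 9 + 9 = 24. In the
  three equations for the values on \<open>V_psi\<close>, \<open>V_rho1\<close> and
  \<open>V_rho2\<close>, solved in this order, the competing root is always -1, which is where
  nonnegativity enters. The equivalence with \<open>M11\<close> is the coordinate map of the given
  basis vector.\<close>

definition mtrace :: "'a::comm_monoid_add mat \<Rightarrow> 'a" where
  "mtrace A = (\<Sum>i<dim_row A. A $$ (i, i))"

text \<open>The matrix type does not fix a size, so an empty sum has no canonical value; the
  dimensions are therefore arguments and the sum is taken entrywise.\<close>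

definition msum :: "nat \<Rightarrow> nat \<Rightarrow> ('i \<Rightarrow> 'a::comm_monoid_add mat) \<Rightarrow> 'i set \<Rightarrow> 'a mat" where
  "msum m n f S = mat m n (\<lambda>(k, l). \<Sum>x\<in>S. f x $$ (k, l))"

lemma index_mult_mat_sum:
  assumes "A \<in> carrier_mat m n" "B \<in> carrier_mat n k" "i < m" "j < k"
  shows "(A * B) $$ (i, j) = (\<Sum>l<n. A $$ (i, l) * B $$ (l, j))"
  using assms by (auto simp: scalar_prod_def lessThan_atLeast0 intro!: sum.cong)

lemma one_smult_mat: "1 \<cdot>\<^sub>m A = (A :: 'a::monoid_mult mat)"
  by (intro eq_matI) auto

lemma smult_smult_mat: "a \<cdot>\<^sub>m (b \<cdot>\<^sub>m A) = (a * b) \<cdot>\<^sub>m (A :: 'a::semigroup_mult mat)"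
  by (intro eq_matI) (auto simp: mult.assoc)

lemma msum_carrier [simp]: "msum m n f S \<in> carrier_mat m n"
  by (simp add: msum_def)

lemma dim_msum [simp]: "dim_row (msum m n f S) = m" "dim_col (msum m n f S) = n"
  by (simp_all add: msum_def)

lemma index_msum: "k < m \<Longrightarrow> l < n \<Longrightarrow> msum m n f S $$ (k, l) = (\<Sum>x\<in>S. f x $$ (k, l))"
  by (simp add: msum_def)

lemma msum_cong: "(\<And>x. x \<in> S \<Longrightarrow> f x = g x) \<Longrightarrow> msum m n f S = msum m n g S"
  by (simp add: msum_def)

lemma msum_mult:
  fixes B :: "'a::comm_ring_1 mat"
  assumes "\<And>x. x \<in> S \<Longrightarrow> f x \<in> carrier_mat m n" "B \<in> carrier_mat n k"
  shows "msum m n f S * B = msum m k (\<lambda>x. f x * B) S"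
proof (rule eq_matI)
  fix i j assume "i < dim_row (msum m k (\<lambda>x. f x * B) S)" "j < dim_col (msum m k (\<lambda>x. f x * B) S)"
  then have ij: "i < m" "j < k" by simp_all
  have "(msum m n f S * B) $$ (i, j) = (\<Sum>l<n. (\<Sum>x\<in>S. f x $$ (i, l)) * B $$ (l, j))"
    using ij assms by (subst index_mult_mat_sum[of _ m n _ k]) (auto simp: index_msum)
  also have "\<dots> = (\<Sum>x\<in>S. \<Sum>l<n. f x $$ (i, l) * B $$ (l, j))"
    by (subst sum.swap) (simp add: sum_distrib_right)
  also have "\<dots> = (\<Sum>x\<in>S. (f x * B) $$ (i, j))"
    by (rule sum.cong[OF refl], subst index_mult_mat_sum[OF assms(1) assms(2) ij]) simp_all
  finally show "(msum m n f S * B) $$ (i, j) = msum m k (\<lambda>x. f x * B) S $$ (i, j)"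
    using ij by (simp add: index_msum)
qed (use assms in auto)

lemma mult_msum:
  fixes B :: "'a::comm_ring_1 mat"
  assumes "\<And>x. x \<in> S \<Longrightarrow> f x \<in> carrier_mat m n" "B \<in> carrier_mat k m"
  shows "B * msum m n f S = msum k n (\<lambda>x. B * f x) S"
proof (rule eq_matI)
  fix i j assume "i < dim_row (msum k n (\<lambda>x. B * f x) S)" "j < dim_col (msum k n (\<lambda>x. B * f x) S)"
  then have ij: "i < k" "j < n" by simp_all
  have "(B * msum m n f S) $$ (i, j) = (\<Sum>l<m. B $$ (i, l) * (\<Sum>x\<in>S. f x $$ (l, j)))"
    using ij assms by (subst index_mult_mat_sum[of _ k m _ n]) (auto simp: index_msum)
  also have "\<dots> = (\<Sum>x\<in>S. \<Sum>l<m. B $$ (i, l) * f x $$ (l, j))"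
    by (subst sum.swap) (simp add: sum_distrib_left)
  also have "\<dots> = (\<Sum>x\<in>S. (B * f x) $$ (i, j))"
    by (rule sum.cong[OF refl], subst index_mult_mat_sum[OF assms(2) assms(1) ij]) simp_all
  finally show "(B * msum m n f S) $$ (i, j) = msum k n (\<lambda>x. B * f x) S $$ (i, j)"
    using ij by (simp add: index_msum)
qed (use assms in auto)

lemma smult_msum:
  fixes c :: "'a::comm_ring_1"
  assumes "\<And>x. x \<in> S \<Longrightarrow> f x \<in> carrier_mat m n"
  shows "c \<cdot>\<^sub>m msum m n f S = msum m n (\<lambda>x. c \<cdot>\<^sub>m f x) S"
  using assms carrier_matD by (intro eq_matI) (fastforce simp: index_msum sum_distrib_left intro!: sum.cong)+

lemma msum_smult:
  fixes B :: "'a::comm_ring_1 mat"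
  assumes "B \<in> carrier_mat m n"
  shows "msum m n (\<lambda>x. c x \<cdot>\<^sub>m B) S = (\<Sum>x\<in>S. c x) \<cdot>\<^sub>m B"
  using assms by (intro eq_matI) (auto simp: index_msum sum_distrib_right)

lemma msum_swap:
  "msum m n (\<lambda>x. msum m n (f x) T) S = msum m n (\<lambda>y. msum m n (\<lambda>x. f x y) S) T"
  by (intro eq_matI) (simp_all add: index_msum sum.swap[of _ S T])

lemma msum_reindex_bij:
  "bij_betw h S T \<Longrightarrow> msum m n (\<lambda>x. f (h x)) S = msum m n f T"
  unfolding msum_def by (rule cong_mat) (auto intro: sum.reindex_bij_betw)

lemma msum_delta:
  fixes f :: "'i \<Rightarrow> 'a::comm_ring_1 mat"
  assumes "finite S" "x \<in> S" "\<And>y. y \<in> S \<Longrightarrow> f y \<in> carrier_mat m n"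
  shows "msum m n (\<lambda>y. of_bool (y = x) \<cdot>\<^sub>m f y) S = f x"
proof (rule eq_matI)
  fix i j assume "i < dim_row (f x)" "j < dim_col (f x)"
  then have ij: "i < m" "j < n" using assms by auto
  have "(\<Sum>y\<in>S. (of_bool (y = x) \<cdot>\<^sub>m f y) $$ (i, j)) = (\<Sum>y\<in>S. if y = x then f y $$ (i, j) else 0)"
    using ij assms(3) by (intro sum.cong) (auto dest!: assms(3))
  then show "msum m n (\<lambda>y. of_bool (y = x) \<cdot>\<^sub>m f y) S $$ (i, j) = f x $$ (i, j)"
    using ij assms by (simp add: index_msum)
qed (use assms in \<open>auto dest!: assms(3)\<close>)

section \<open>Traces, and rank factorization of idempotents\<close>

lemma mtrace_eq_sum: "A \<in> carrier_mat m m \<Longrightarrow> mtrace A = (\<Sum>i<m. A $$ (i, i))"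
  by (simp add: mtrace_def)

lemma mtrace_smult: "A \<in> carrier_mat m m \<Longrightarrow> mtrace (c \<cdot>\<^sub>m A) = c * mtrace (A :: 'a::comm_ring_1 mat)"
  by (auto simp: mtrace_def sum_distrib_left intro!: sum.cong)

lemma mtrace_msum:
  assumes "\<And>x. x \<in> S \<Longrightarrow> f x \<in> carrier_mat m m"
  shows "mtrace (msum m m f S) = (\<Sum>x\<in>S. mtrace (f x))"
proof -
  have "mtrace (f x) = (\<Sum>i<m. f x $$ (i, i))" if "x \<in> S" for x
    using assms[OF that] by (simp add: mtrace_def)
  then show ?thesis
    by (simp add: mtrace_def index_msum sum.swap[of _ S])
qed

lemma mtrace_one: "mtrace (1\<^sub>m m :: 'a::semiring_1 mat) = of_nat m"
  by (simp add: mtrace_def)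

lemma mtrace_mult_comm:
  fixes A :: "'a::comm_ring_1 mat"
  assumes "A \<in> carrier_mat m n" "B \<in> carrier_mat n m"
  shows "mtrace (A * B) = mtrace (B * A)"
proof -
  have "mtrace (A * B) = (\<Sum>i<m. \<Sum>l<n. A $$ (i, l) * B $$ (l, i))"
    using assms index_mult_mat_sum[OF assms] by (simp add: mtrace_def del: index_mult_mat(1))
  also have "\<dots> = (\<Sum>l<n. \<Sum>i<m. B $$ (l, i) * A $$ (i, l))"
    by (subst sum.swap) (simp add: mult.commute)
  also have "\<dots> = mtrace (B * A)"
    using assms index_mult_mat_sum[OF assms(2,1)] by (simp add: mtrace_def del: index_mult_mat(1))
  finally show ?thesis .
qed

text \<open>Induction on the number of nonzero columns: subtracting \<open>v w\<close>, where \<open>v\<close> is a nonzero column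
  and \<open>w\<close> a row scaled so that \<open>w v = 1\<close>, clears that column.\<close>

lemma idempotent_rank_decomposition:
  fixes E :: "nat \<Rightarrow> nat \<Rightarrow> 'a::field"
  assumes "\<forall>k<m. \<forall>l<m. (\<Sum>j<m. E k j * E j l) = E k l"
  shows "\<exists>(r::nat) v w. (\<forall>k<m. \<forall>l<m. E k l = (\<Sum>t<r. v k t * w t l)) \<and>
           (\<forall>s<r. \<forall>t<r. (\<Sum>k<m. w s k * v k t) = of_bool (s = t))"
  using assms
proof (induction "card {l. l < m \<and> (\<exists>k<m. E k l \<noteq> 0)}" arbitrary: E rule: less_induct)
  case less
  note idem = less.prems
  show ?case
  proof (cases "\<exists>k<m. \<exists>l<m. E k l \<noteq> 0")
    case False
    then show ?thesis by (intro exI[of _ 0]) auto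
  next
    case True
    then obtain p q where pq: "p < m" "q < m" "E p q \<noteq> 0" by blast
    \<comment> \<open>A column and a row of \<open>E\<close> are fixed by \<open>E\<close> on their
      sides; dividing the row by the pivot \<open>E p q\<close> makes \<open>y x = 1\<close>, since
      the entry of \<open>E E\<close> at \<open>(p, q)\<close> is the pivot again.\<close>
    define x where "x k = E k q" for k
    define y where "y l = E p l / E p q" for l
    define F where "F k l = E k l - x k * y l" for k l
    have Ex: "(\<Sum>j<m. E k j * x j) = x k" if "k < m" for k
      using idem that pq by (simp add: x_def)
    have yE: "(\<Sum>j<m. y j * E j l) = y l" if "l < m" for l
      using idem that pq by (simp add: y_def flip: sum_divide_distrib)
    have yx: "(\<Sum>j<m. y j * x j) = 1"
      using yE[of q] pq by (simp add: x_def y_def)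
    have Fidem: "(\<Sum>j<m. F k j * F j l) = F k l" if "k < m" "l < m" for k l
    proof -
      have "(\<Sum>j<m. F k j * F j l) = (\<Sum>j<m. E k j * E j l) - (\<Sum>j<m. E k j * x j) * y l
          - x k * (\<Sum>j<m. y j * E j l) + x k * (\<Sum>j<m. y j * x j) * y l"
        by (simp add: F_def algebra_simps sum.distrib sum_subtractf sum_distrib_left)
      then show ?thesis using idem Ex yE yx that by (simp add: F_def)
    qed
    have Fx: "(\<Sum>j<m. F k j * x j) = 0" if "k < m" for k
    proof -
      have "(\<Sum>j<m. F k j * x j) = (\<Sum>j<m. E k j * x j) - x k * (\<Sum>j<m. y j * x j)"
        by (simp add: F_def algebra_simps sum_subtractf sum_distrib_left)
      then show ?thesis using Ex yx that by simp
    qed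
    have yF: "(\<Sum>j<m. y j * F j l) = 0" if "l < m" for l
    proof -
      have "(\<Sum>j<m. y j * F j l) = (\<Sum>j<m. y j * E j l) - (\<Sum>j<m. y j * x j) * y l"
        by (simp add: F_def algebra_simps sum_subtractf sum_distrib_left)
      then show ?thesis using yE yx that by simp
    qed
    \<comment> \<open>A zero column of \<open>E\<close> has \<open>y l = 0\<close> and stays zero,
      while column \<open>q\<close> is cleared because \<open>y q = 1\<close>.\<close>
    have "{l. l < m \<and> (\<exists>k<m. F k l \<noteq> 0)} \<subset> {l. l < m \<and> (\<exists>k<m. E k l \<noteq> 0)}"
    proof
      show "{l. l < m \<and> (\<exists>k<m. F k l \<noteq> 0)} \<subseteq> {l. l < m \<and> (\<exists>k<m. E k l \<noteq> 0)}"
      proof -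
        have "F k l = 0" if "k < m" "\<forall>k<m. E k l = 0" for k l
          using that pq by (simp add: F_def y_def)
        then show ?thesis by blast
      qed
      have "F k q = 0" for k using pq by (simp add: F_def x_def y_def)
      then show "{l. l < m \<and> (\<exists>k<m. F k l \<noteq> 0)} \<noteq> {l. l < m \<and> (\<exists>k<m. E k l \<noteq> 0)}"
        using pq by auto
    qed
    then have "card {l. l < m \<and> (\<exists>k<m. F k l \<noteq> 0)} < card {l. l < m \<and> (\<exists>k<m. E k l \<noteq> 0)}"
      by (intro psubset_card_mono) auto

    moreover have "\<forall>k<m. \<forall>l<m. (\<Sum>j<m. F k j * F j l) = F k l" using Fidem by blast
    ultimately have "\<exists>(r::nat) v w. (\<forall>k<m. \<forall>l<m. F k l = (\<Sum>t<r. v k t * w t l)) \<and>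
        (\<forall>s<r. \<forall>t<r. (\<Sum>k<m. w s k * v k t) = of_bool (s = t))"
      by (rule less.hyps)
    then obtain r :: nat and v w
      where F: "\<And>k l. k < m \<Longrightarrow> l < m \<Longrightarrow> F k l = (\<Sum>t<r. v k t * w t l)"
        and wv: "\<And>s t. s < r \<Longrightarrow> t < r \<Longrightarrow> (\<Sum>k<m. w s k * v k t) = of_bool (s = t)"
      by blast
    have wF: "(\<Sum>k<m. w s k * F k l) = w s l" if "s < r" "l < m" for s l
    proof -
      have "(\<Sum>k<m. w s k * F k l) = (\<Sum>t<r. (\<Sum>k<m. w s k * v k t) * w t l)"
        using that by (simp add: F sum_distrib_left sum_distrib_right mult.assoc) (rule sum.swap)
      also have "\<dots> = (\<Sum>t<r. if t = s then w t l else 0)"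
        using that by (intro sum.cong) (auto simp: wv)
      finally show ?thesis using that by simp
    qed
    have Fv: "(\<Sum>l<m. F k l * v l t) = v k t" if "t < r" "k < m" for k t
    proof -
      have "(\<Sum>l<m. F k l * v l t) = (\<Sum>s<r. v k s * (\<Sum>l<m. w s l * v l t))"
        using that by (simp add: F sum_distrib_left sum_distrib_right mult.assoc) (rule sum.swap)
      also have "\<dots> = (\<Sum>s<r. if s = t then v k s else 0)"
        using that by (intro sum.cong) (auto simp: wv)
      finally show ?thesis using that by simp
    qed
    \<comment> \<open>Each \<open>w s\<close> is fixed by right multiplication with
      \<open>F\<close>, and \<open>F\<close> kills \<open>x\<close>; dually for \<open>yv\<close>.
      So the new pair can be appended without spoiling duality.\<close>
    have wx: "(\<Sum>k<m. w s k * x k) = 0" if "s < r" for s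
    proof -
      have "(\<Sum>k<m. w s k * x k) = (\<Sum>k<m. \<Sum>j<m. w s j * F j k * x k)"
        using that by (intro sum.cong refl) (simp add: wF flip: sum_distrib_right)
      also have "\<dots> = (\<Sum>j<m. w s j * (\<Sum>k<m. F j k * x k))"
        by (subst sum.swap) (simp add: sum_distrib_left mult.assoc)
      finally show ?thesis by (simp add: Fx)
    qed
    have yv: "(\<Sum>k<m. y k * v k t) = 0" if "t < r" for t
    proof -
      have "(\<Sum>k<m. y k * v k t) = (\<Sum>k<m. \<Sum>l<m. y k * F k l * v l t)"
        using that by (intro sum.cong refl) (simp add: Fv mult.assoc flip: sum_distrib_left)
      also have "\<dots> = (\<Sum>l<m. (\<Sum>k<m. y k * F k l) * v l t)"
        by (subst sum.swap) (simp add: sum_distrib_right)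
      finally show ?thesis by (simp add: yF)
    qed
    show ?thesis
    proof (intro exI conjI allI impI)
      fix k l assume "k < m" "l < m"
      then have "E k l = (\<Sum>t<r. v k t * w t l) + x k * y l"
        using F by (simp add: F_def flip: F)
      then show "E k l = (\<Sum>t<Suc r. (if t = r then x k else v k t) * (if t = r then y l else w t l))"
        by simp
    next
      fix s t assume "s < Suc r" "t < Suc r"
      then show "(\<Sum>k<m. (if s = r then y k else w s k) * (if t = r then x k else v k t))
          = of_bool (s = t)"
        using yx yv wx wv by (cases "s = r"; cases "t = r") auto
    qed
  qed
qed

text \<open>\<open>V\<close> and \<open>W\<close> identify the image of \<open>E\<close> with an
  \<open>r\<close>-dimensional coordinate space; cyclicity turns the trace of \<open>V * W\<close>
  into that of the identity of size \<open>r\<close>. Multiplicities become natural numbers through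
  this.\<close>

lemma idempotent_mat_factorization:
  fixes E :: "'a::field mat"
  assumes "E \<in> carrier_mat m m" "E * E = E"
  obtains r V W where "V \<in> carrier_mat m r" "W \<in> carrier_mat r m" "V * W = E" "W * V = 1\<^sub>m r"
    "mtrace E = of_nat r"
proof -
  have "(\<Sum>j<m. E $$ (k, j) * E $$ (j, l)) = E $$ (k, l)" if "k < m" "l < m" for k l
    using index_mult_mat_sum[OF assms(1) assms(1) that] assms(2) by simp
  then have "\<forall>k<m. \<forall>l<m. (\<Sum>j<m. E $$ (k, j) * E $$ (j, l)) = E $$ (k, l)" by blast
  from idempotent_rank_decomposition[OF this] obtain r :: nat and v w
    where vw: "\<forall>k<m. \<forall>l<m. E $$ (k, l) = (\<Sum>t<r. v k t * w t l)"
      and wv: "\<forall>s<r. \<forall>t<r. (\<Sum>k<m. w s k * v k t) = of_bool (s = t)"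
    by blast
  define V where "V = mat m r (\<lambda>(k, t). v k t)"
  define W where "W = mat r m (\<lambda>(t, l). w t l)"
  have V: "V \<in> carrier_mat m r" and W: "W \<in> carrier_mat r m" by (simp_all add: V_def W_def)
  have VW: "V * W = E"
    using assms(1) vw V W
    by (intro eq_matI)
      (simp_all add: index_mult_mat_sum[OF V W] carrier_matD del: index_mult_mat(1), simp add: V_def W_def)
  have WV: "W * V = 1\<^sub>m r"
    using wv V W
    by (intro eq_matI)
      (simp_all add: index_mult_mat_sum[OF W V] carrier_matD del: index_mult_mat(1), simp add: V_def W_def)
  have "mtrace E = of_nat r"
    using mtrace_mult_comm[OF V W] by (simp add: VW WV mtrace_one)
  with V W VW WV show thesis by (rule that)
qed

text \<open>Enumerating both index sets by \<open>{..<n}\<close> gives square matrices, for which a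
  one-sided inverse is two-sided. Arbitrary index sets are needed because one side will be indexed
  by group elements and the other by block positions.\<close>

lemma left_inverse_imp_right_inverse_fun:
  fixes f :: "'a \<Rightarrow> 'b \<Rightarrow> 'c::field"
  assumes fin: "finite A" "finite B" "card A = card B"
    and left: "\<And>x y. x \<in> A \<Longrightarrow> y \<in> A \<Longrightarrow> (\<Sum>b\<in>B. f x b * g b y) = of_bool (x = y)"
    and "b \<in> B" "b' \<in> B"
  shows "(\<Sum>x\<in>A. g b x * f x b') = of_bool (b = b')"
proof -
  define n where "n = card A"
  obtain \<alpha> where \<alpha>: "bij_betw \<alpha> {..<n} A"
    using ex_bij_betw_nat_finite[OF fin(1)] by (auto simp: n_def lessThan_atLeast0)
  obtain \<beta> where \<beta>: "bij_betw \<beta> {..<n} B"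
    using ex_bij_betw_nat_finite[OF fin(2)] fin(3) by (auto simp: n_def lessThan_atLeast0)
  define F where "F = mat n n (\<lambda>(i, j). f (\<alpha> i) (\<beta> j))"
  define H where "H = mat n n (\<lambda>(i, j). g (\<beta> i) (\<alpha> j))"
  have F: "F \<in> carrier_mat n n" and H: "H \<in> carrier_mat n n" by (simp_all add: F_def H_def)
  have "(F * H) $$ (i, j) = of_bool (i = j)" if "i < n" "j < n" for i j
  proof -
    have "\<alpha> i \<in> A" "\<alpha> j \<in> A" using \<alpha> that by (auto dest: bij_betwE)
    moreover have "\<alpha> i = \<alpha> j \<longleftrightarrow> i = j"
      using \<alpha> that by (auto simp: bij_betw_def inj_on_def)
    ultimately show ?thesis
      using left[of "\<alpha> i" "\<alpha> j"] that
        sum.reindex_bij_betw[OF \<beta>, of "\<lambda>b. f (\<alpha> i) b * g b (\<alpha> j)"]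
      by (subst index_mult_mat_sum[OF F H]) (simp_all add: F_def H_def)
  qed
  then have "F * H = 1\<^sub>m n" using F H by (intro eq_matI) auto
  then have HF: "H * F = 1\<^sub>m n" by (rule mat_mult_left_right_inverse[OF F H])
  from \<beta> \<open>b \<in> B\<close> \<open>b' \<in> B\<close> obtain i j where ij: "i < n" "j < n" "b = \<beta> i" "b' = \<beta> j"
    by (metis bij_betw_imp_surj_on imageE lessThan_iff)
  have "(\<Sum>x\<in>A. g b x * f x b') = (\<Sum>k<n. g b (\<alpha> k) * f (\<alpha> k) b')"
    using sum.reindex_bij_betw[OF \<alpha>, of "\<lambda>x. g b x * f x b'"] by simp
  also have "\<dots> = (H * F) $$ (i, j)"
    using ij by (subst index_mult_mat_sum[OF H F]) (simp_all add: F_def H_def)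
  also have "\<dots> = of_bool (i = j)" using HF ij by simp
  also have "\<dots> = of_bool (b = b')"
    using \<beta> ij by (auto simp: bij_betw_def inj_on_def)
  finally show ?thesis .
qed

section \<open>Operations on representations\<close>

text \<open>The encoding of pairs is \<open>i * q + j\<close>, the one used by
  \<open>kronecker\<close>. For \<open>q = 0\<close> both sides are zero.\<close>

lemma sum_div_mod:
  fixes f :: "nat \<Rightarrow> nat \<Rightarrow> 'a::comm_monoid_add"
  shows "(\<Sum>t<n * q. f (t div q) (t mod q)) = (\<Sum>i<n. \<Sum>j<q. f i j)"
proof (cases "q = 0")
  case False
  have less: "i * q + j < n * q" if "i < n" "j < q" for i j
  proof -
    have "i * q + j < Suc i * q" using that by simp
    also have "\<dots> \<le> n * q" using that by (intro mult_right_mono) auto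
    finally show ?thesis .
  qed
  show ?thesis
    unfolding sum.cartesian_product
    by (rule sum.reindex_bij_witness[where i = "\<lambda>(i, j). i * q + j" and j = "\<lambda>t. (t div q, t mod q)"])
      (use False less in \<open>auto simp: less_mult_imp_div_less\<close>)
qed simp

section \<open>Kronecker products and block matrices\<close>

lemma kronecker_carrier [simp]:
  "A \<in> carrier_mat m n \<Longrightarrow> B \<in> carrier_mat p q \<Longrightarrow> kronecker A B \<in> carrier_mat (m * p) (n * q)"
  by (auto simp: kronecker_def)

lemma index_kronecker:
  assumes "A \<in> carrier_mat m n" "B \<in> carrier_mat p q" "i < m * p" "j < n * q"
  shows "kronecker A B $$ (i, j) = A $$ (i div p, j div q) * B $$ (i mod p, j mod q)"
  using assms by (auto simp: kronecker_def)

text \<open>The inner sum runs over encoded pairs, and after decoding it factors into the inner sums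
  of \<open>A * C\<close> and \<open>B * D\<close>.\<close>

lemma kronecker_mult:
  fixes A :: "'a::comm_ring_1 mat"
  assumes "A \<in> carrier_mat m n" "B \<in> carrier_mat p q" "C \<in> carrier_mat n k" "D \<in> carrier_mat q l"
  shows "kronecker A B * kronecker C D = kronecker (A * C) (B * D)"
proof (rule eq_matI)
  fix i j assume "i < dim_row (kronecker (A * C) (B * D))" "j < dim_col (kronecker (A * C) (B * D))"
  then have ij: "i < m * p" "j < k * l" using assms by (simp_all add: kronecker_def)
  then have "0 < p" "0 < l" by (auto intro!: gr0I)
  then have small: "i div p < m" "i mod p < p" "j div l < k" "j mod l < l"
    using ij by (auto simp: less_mult_imp_div_less)
  have "(kronecker A B * kronecker C D) $$ (i, j) =
      (\<Sum>t<n * q. A $$ (i div p, t div q) * B $$ (i mod p, t mod q) *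
        (C $$ (t div q, j div l) * D $$ (t mod q, j mod l)))"
    using assms ij
    by (simp add: index_mult_mat_sum[OF kronecker_carrier[OF assms(1,2)] kronecker_carrier[OF assms(3,4)]]
        index_kronecker[OF assms(1,2)] index_kronecker[OF assms(3,4)] del: index_mult_mat(1))
  also have "\<dots> = (\<Sum>s<n. A $$ (i div p, s) * C $$ (s, j div l)) *
      (\<Sum>t<q. B $$ (i mod p, t) * D $$ (t, j mod l))"
    by (subst sum_div_mod[where f = "\<lambda>s t. A $$ (i div p, s) * B $$ (i mod p, t) *
        (C $$ (s, j div l) * D $$ (t, j mod l))"])
      (simp add: sum_product mult_ac)
  also have "\<dots> = kronecker (A * C) (B * D) $$ (i, j)"
    using assms ij small
    by (simp add: index_kronecker[of _ m k _ p l] index_mult_mat_sum[OF assms(1,3)]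
        index_mult_mat_sum[OF assms(2,4)] del: index_mult_mat(1))
  finally show "(kronecker A B * kronecker C D) $$ (i, j) = kronecker (A * C) (B * D) $$ (i, j)" .
qed (use assms in \<open>auto simp: kronecker_def\<close>)

lemma kronecker_one: "kronecker (1\<^sub>m m) (1\<^sub>m n) = (1\<^sub>m (m * n) :: 'a::semiring_1 mat)"
proof (rule eq_matI)
  fix i j assume "i < dim_row (1\<^sub>m (m * n) :: 'a mat)" "j < dim_col (1\<^sub>m (m * n) :: 'a mat)"
  then have ij: "i < m * n" "j < m * n" by simp_all
  then have "0 < n" by (auto intro!: gr0I)
  moreover have "i = j \<longleftrightarrow> i div n = j div n \<and> i mod n = j mod n" by (metis div_mult_mod_eq)
  ultimately show "kronecker (1\<^sub>m m) (1\<^sub>m n) $$ (i, j) = (1\<^sub>m (m * n) :: 'a mat) $$ (i, j)"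
    using ij by (auto simp: kronecker_def less_mult_imp_div_less)
qed (simp_all add: kronecker_def)

lemma mtrace_kronecker:
  fixes A :: "'a::comm_ring_1 mat"
  assumes "A \<in> carrier_mat m m" "B \<in> carrier_mat n n"
  shows "mtrace (kronecker A B) = mtrace A * mtrace B"
proof -
  have "mtrace (kronecker A B) = (\<Sum>t<m * n. A $$ (t div n, t div n) * B $$ (t mod n, t mod n))"
    using assms by (auto simp: mtrace_def kronecker_def intro!: sum.cong)
  also have "\<dots> = (\<Sum>s<m. \<Sum>t<n. A $$ (s, s) * B $$ (t, t))"
    by (rule sum_div_mod)
  finally show ?thesis using assms by (simp add: mtrace_def sum_product)
qed

lemma mtrace_four_block:
  fixes A :: "'a::comm_monoid_add mat"
  assumes "A \<in> carrier_mat m m" "D \<in> carrier_mat n n"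
  shows "mtrace (four_block_mat A B C D) = mtrace A + mtrace D"
proof -
  have "mtrace (four_block_mat A B C D) = (\<Sum>i<m + n. if i < m then A $$ (i, i) else D $$ (i - m, i - m))"
    using assms by (auto simp: mtrace_def intro!: sum.cong)
  also have "{..<m + n} = {..<m} \<union> {m..<m + n}" by auto
  also have "(\<Sum>i\<in>\<dots>. if i < m then A $$ (i, i) else D $$ (i - m, i - m)) =
      (\<Sum>i<m. A $$ (i, i)) + (\<Sum>i\<in>{m..<m + n}. D $$ (i - m, i - m))"
    by (subst sum.union_disjoint) (auto intro!: arg_cong2[where f = "(+)"] sum.cong)
  also have "(\<Sum>i\<in>{m..<m + n}. D $$ (i - m, i - m)) = (\<Sum>i<n. D $$ (i, i))"
    by (rule sum.reindex_bij_witness[where i = "\<lambda>i. i + m" and j = "\<lambda>i. i - m"]) auto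
  finally show ?thesis using assms by (simp add: mtrace_def)
qed

section \<open>Direct sums, tensor products and isomorphisms of representations\<close>

lemma representationD:
  assumes "representation G m \<rho>"
  shows "\<And>g. g \<in> carrier G \<Longrightarrow> \<rho> g \<in> carrier_mat m m" "\<rho> \<one>\<^bsub>G\<^esub> = 1\<^sub>m m"
    "\<And>g h. g \<in> carrier G \<Longrightarrow> h \<in> carrier G \<Longrightarrow> \<rho> (g \<otimes>\<^bsub>G\<^esub> h) = \<rho> g * \<rho> h"
  using assms by (auto simp: representation_def)

lemma representation_zero: "representation G 0 zero_rep"
  by (auto simp: representation_def zero_rep_def)

lemma representation_trivial: "representation G 1 trivial_rep"
  by (auto simp: representation_def trivial_rep_def)

lemma representation_dsum:
  assumes "representation G m \<rho>" "representation G n \<sigma>"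
  shows "representation G (m + n) (dsum_rep \<rho> \<sigma>)"
proof -
  have *: "dsum_rep \<rho> \<sigma> g = four_block_mat (\<rho> g) (0\<^sub>m m n) (0\<^sub>m n m) (\<sigma> g)" if "\<rho> g \<in> carrier_mat m m" "\<sigma> g \<in> carrier_mat n n" for g
    using that by (auto simp: dsum_rep_def)
  show ?thesis
    unfolding representation_def
  proof (intro conjI ballI)
    fix g h assume gh: "g \<in> carrier G" "h \<in> carrier G"
    note c = representationD(1)[OF assms(1) gh(1)] representationD(1)[OF assms(1) gh(2)]
      representationD(1)[OF assms(2) gh(1)] representationD(1)[OF assms(2) gh(2)]
    show "dsum_rep \<rho> \<sigma> (g \<otimes>\<^bsub>G\<^esub> h) = dsum_rep \<rho> \<sigma> g * dsum_rep \<rho> \<sigma> h"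
      using c gh representationD(3)[OF assms(1) gh] representationD(3)[OF assms(2) gh]
      by (subst (1 2 3) *) (auto simp: mult_four_block_mat[where ?nr1.0 = m and ?n1.0 = m and ?n2.0 = n
            and ?nr2.0 = n and ?nc1.0 = m and ?nc2.0 = n])
  next
    fix g assume "g \<in> carrier G"
    then show "dsum_rep \<rho> \<sigma> g \<in> carrier_mat (m + n) (m + n)"
      using assms by (simp add: * representationD(1))
  next
    show "dsum_rep \<rho> \<sigma> \<one>\<^bsub>G\<^esub> = 1\<^sub>m (m + n)"
      using assms by (subst *) (auto simp: representationD(2) intro!: eq_matI)
  qed
qed

lemma mtrace_dsum:
  assumes "representation G m \<rho>" "representation G n \<sigma>" "g \<in> carrier G"
  shows "mtrace (dsum_rep \<rho> \<sigma> g) = mtrace (\<rho> g) + mtrace (\<sigma> g)"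
  using assms unfolding dsum_rep_def by (intro mtrace_four_block representationD(1))

lemma representation_tensor:
  assumes "representation G m \<rho>" "representation G n \<sigma>"
  shows "representation G (m * n) (tensor_rep \<rho> \<sigma>)"
  unfolding representation_def tensor_rep_def
  using assms
  by (auto simp: representationD kronecker_one
      intro!: kronecker_mult[symmetric, where m = m and n = m and p = n and q = n and k = m and l = n])

lemma mtrace_tensor:
  assumes "representation G m \<rho>" "representation G n \<sigma>" "g \<in> carrier G"
  shows "mtrace (tensor_rep \<rho> \<sigma> g) = mtrace (\<rho> g) * mtrace (\<sigma> g)"
  using assms unfolding tensor_rep_def by (intro mtrace_kronecker representationD(1))

lemma mtrace_rep_iso:
  assumes "rep_iso G \<rho> \<sigma>" "g \<in> carrier G"
  shows "mtrace (\<rho> g) = mtrace (\<sigma> g)"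
proof -
  from assms obtain m P where r: "representation G m \<rho>" "representation G m \<sigma>"
    and P: "P \<in> carrier_mat m m" "invertible_mat P" "P * \<rho> g = \<sigma> g * P"
    by (auto simp: rep_iso_def)
  from P obtain Q where PQ: "P * Q = 1\<^sub>m m" and QP: "Q * P = 1\<^sub>m (dim_row Q)"
    by (auto simp: invertible_mat_def inverts_mat_def)
  \<comment> \<open>\<open>invertible_mat\<close> leaves the size of the inverse open; it is read
    off from the two product identities.\<close>
  have "dim_col Q = m" using arg_cong[OF PQ, of dim_col] by simp
  moreover have "dim_row Q = m" using arg_cong[OF QP, of dim_col] P(1) by auto
  ultimately have Q: "Q \<in> carrier_mat m m" by auto
  with QP have QP: "Q * P = 1\<^sub>m m" by auto
  note c = representationD(1)[OF r(1) assms(2)] representationD(1)[OF r(2) assms(2)]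
  have "mtrace (\<rho> g) = mtrace ((Q * P) * \<rho> g)"
    using c by (simp add: QP)
  also have "\<dots> = mtrace (Q * (\<sigma> g * P))"
    using c Q P by (simp add: assoc_mult_mat[of _ m m _ m _ m])
  also have "\<dots> = mtrace ((\<sigma> g * P) * Q)"
    using c Q P by (intro mtrace_mult_comm[of _ m m]) auto
  also have "\<dots> = mtrace (\<sigma> g * (P * Q))"
    using c Q P by (simp add: assoc_mult_mat[of _ m m _ m _ m])
  finally show ?thesis using c by (simp add: PQ)
qed

section \<open>Complete families of irreducible representations\<close>

text \<open>The last assumption says that the family affords the regular character. It replaces
  irreducibility, pairwise inequivalence and completeness, all of which follow from it.\<close>

locale regular_family = group G for G :: "('g, 'c) monoid_scheme" (structure) +
  fixes I :: "'i set" and d :: "'i \<Rightarrow> nat" and R :: "'i \<Rightarrow> 'g rep"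
  assumes finite_carrier: "finite (carrier G)"
    and finite_I: "finite I"
    and d_pos: "i \<in> I \<Longrightarrow> 0 < d i"
    and rep_R: "i \<in> I \<Longrightarrow> representation G (d i) (R i)"
    and regular: "g \<in> carrier G \<Longrightarrow>
      (\<Sum>i\<in>I. of_nat (d i) * mtrace (R i g)) = (if g = \<one> then of_nat (card (carrier G)) else 0)"
begin

section \<open>Schur orthogonality and independence of characters\<close>

lemmas R_carrier = representationD(1)[OF rep_R]

lemma index_R_mult:
  assumes "i \<in> I" "g \<in> carrier G" "h \<in> carrier G" "a < d i" "b < d i"
  shows "R i (g \<otimes> h) $$ (a, b) = (\<Sum>c<d i. R i g $$ (a, c) * R i h $$ (c, b))"
  using representationD(3)[OF rep_R[OF assms(1)] assms(2,3)] assms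
  by (simp add: index_mult_mat_sum[OF R_carrier R_carrier] del: index_mult_mat(1))

text \<open>This is \<open>regular\<close> at the identity, where each trace equals the
  degree.\<close>

lemma sum_squares_d: "(\<Sum>i\<in>I. (d i)\<^sup>2) = card (carrier G)"
proof -
  have "(\<Sum>i\<in>I. of_nat (d i) * mtrace (R i \<one>)) = (of_nat (card (carrier G)) :: complex)"
    using regular[of \<one>] by simp
  moreover have "(\<Sum>i\<in>I. of_nat (d i) * mtrace (R i \<one>)) = (of_nat (\<Sum>i\<in>I. (d i)\<^sup>2) :: complex)"
    by (auto simp: representationD(2)[OF rep_R] mtrace_one power2_eq_square intro!: sum.cong)
  ultimately show ?thesis using of_nat_eq_iff by metis
qed

text \<open>The regular character identity says that the square matrix of all coefficients has a left
  inverse; it is therefore also a right inverse, which is the orthogonality relation.\<close>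

lemma schur_orthogonality:
  assumes "i \<in> I" "j \<in> I" "b < d i" "e < d i" "c < d j" "f < d j"
  shows "(\<Sum>g\<in>carrier G. (of_nat (d j) / of_nat (card (carrier G)) * R j (inv g) $$ (f, c)) * R i g $$ (b, e))
    = of_bool (i = j \<and> b = c \<and> e = f)"
proof -
  define T where "T = Sigma I (\<lambda>i. {..<d i} \<times> {..<d i})"
  define n where "n = (of_nat (card (carrier G)) :: complex)"
  have n: "n \<noteq> 0"
    using finite_carrier by (auto simp: n_def)
  have T: "finite T" "card (carrier G) = card T"
    using finite_I sum_squares_d by (simp_all add: T_def power2_eq_square)
  \<comment> \<open>Group elements index one side of the two square matrices, triples of a block and
    a position in it the other.\<close>
  have "(\<Sum>g\<in>carrier G. (case (i, b, e) of (i, b, e) \<Rightarrow> R i g $$ (b, e)) *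
      (case (j, c, f) of (j, c, f) \<Rightarrow> of_nat (d j) / n * R j (inv g) $$ (f, c))) = of_bool ((i, b, e) = (j, c, f))"
  proof (rule left_inverse_imp_right_inverse_fun[OF finite_carrier T])
    fix g h assume gh: "g \<in> carrier G" "h \<in> carrier G"
    have "(\<Sum>t\<in>T. (case t of (j, c, f) \<Rightarrow> of_nat (d j) / n * R j (inv g) $$ (f, c)) *
        (case t of (i, b, e) \<Rightarrow> R i h $$ (b, e))) =
        (\<Sum>j\<in>I. \<Sum>(c, f)\<in>{..<d j} \<times> {..<d j}. of_nat (d j) / n * R j (inv g) $$ (f, c) * R j h $$ (c, f))"
      unfolding T_def using finite_I by (subst sum.Sigma) (auto simp: case_prod_beta)
    also have "\<dots> = (\<Sum>j\<in>I. of_nat (d j) / n * (\<Sum>f<d j. \<Sum>c<d j. R j (inv g) $$ (f, c) * R j h $$ (c, f)))"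
      by (intro sum.cong refl, subst sum.cartesian_product[symmetric], subst sum.swap)
        (simp add: sum_distrib_left mult.assoc)
    \<comment> \<open>Summing over all positions of a block produces the trace at
      \<open>inv g \<otimes> h\<close>, so the regular character detects
      \<open>g = h\<close>.\<close>
    also have "\<dots> = (\<Sum>j\<in>I. of_nat (d j) * mtrace (R j (inv g \<otimes> h))) / n"
      unfolding sum_divide_distrib
    proof (intro sum.cong refl)
      fix j assume j: "j \<in> I"
      have "mtrace (R j (inv g \<otimes> h)) = (\<Sum>f<d j. \<Sum>c<d j. R j (inv g) $$ (f, c) * R j h $$ (c, f))"
        using gh j R_carrier[OF j, of "inv g \<otimes> h"] by (simp add: mtrace_def index_R_mult)
      then show "of_nat (d j) / n * (\<Sum>f<d j. \<Sum>c<d j. R j (inv g) $$ (f, c) * R j h $$ (c, f)) =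
          of_nat (d j) * mtrace (R j (inv g \<otimes> h)) / n" by simp
    qed
    also have "\<dots> = of_bool (g = h)"
      using regular[of "inv g \<otimes> h"] gh n inv_solve_left'[of \<one> g h] by (auto simp: n_def)
    finally show "(\<Sum>t\<in>T. (case t of (j, c, f) \<Rightarrow> of_nat (d j) / n * R j (inv g) $$ (f, c)) *
        (case t of (i, b, e) \<Rightarrow> R i h $$ (b, e))) = of_bool (g = h)" .
  qed (use assms in \<open>auto simp: T_def\<close>)
  then show ?thesis by (simp add: n_def mult.commute)
qed

text \<open>By orthogonality, pairing with the \<open>(0, 0)\<close> coefficient of
  \<open>R j\<close> at inverses retains only the entry \<open>(0, 0)\<close> of \<open>R j\<close>
  and nothing of the other blocks, hence sends the character of \<open>R i\<close> to
  \<open>of_bool (i = j)\<close>. The index 0 exists by \<open>d_pos\<close>.\<close>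

lemma characters_independent:
  assumes "\<And>g. g \<in> carrier G \<Longrightarrow> (\<Sum>i\<in>I. c i * mtrace (R i g)) = 0" "j \<in> I"
  shows "c j = 0"
proof -
  define k where "k g = of_nat (d j) / of_nat (card (carrier G)) * R j (inv g) $$ (0, 0)" for g
  have *: "(\<Sum>g\<in>carrier G. k g * mtrace (R i g)) = of_bool (i = j)" if i: "i \<in> I" for i
  proof -
    have "(\<Sum>g\<in>carrier G. k g * mtrace (R i g)) = (\<Sum>g\<in>carrier G. \<Sum>b<d i. k g * R i g $$ (b, b))"
      by (intro sum.cong refl) (simp add: mtrace_eq_sum[OF R_carrier[OF i]] sum_distrib_left)
    also have "\<dots> = (\<Sum>b<d i. of_bool (i = j \<and> b = 0))"
    proof (subst sum.swap, rule sum.cong[OF refl])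
      fix b assume "b \<in> {..<d i}"
      then show "(\<Sum>g\<in>carrier G. k g * R i g $$ (b, b)) = of_bool (i = j \<and> b = 0)"
        using schur_orthogonality[OF i assms(2), of b b 0 0] d_pos[OF assms(2)] by (simp add: k_def)
    qed
    also have "\<dots> = of_bool (i = j)"
      using d_pos[OF i] by (cases "i = j") (simp_all add: of_bool_def)
    finally show ?thesis .
  qed
  have "0 = (\<Sum>g\<in>carrier G. k g * (\<Sum>i\<in>I. c i * mtrace (R i g)))"
    using assms(1) by simp
  also have "\<dots> = (\<Sum>i\<in>I. c i * (\<Sum>g\<in>carrier G. k g * mtrace (R i g)))"
    by (simp add: sum_distrib_left, subst sum.swap) (simp add: mult_ac)
  also have "\<dots> = (\<Sum>i\<in>I. c i * of_bool (i = j))"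
    by (simp add: *)
  also have "\<dots> = (\<Sum>i\<in>I. if i = j then c i else 0)" by (intro sum.cong) auto
  also have "\<dots> = c j"
    using finite_I assms(2) by simp
  finally show ?thesis by simp
qed

text \<open>The image under \<open>\<rho>\<close> of the matrix unit \<open>(a, b)\<close> in the
  \<open>i\<close>-th Wedderburn block of the group algebra. The transposed indices
  \<open>(b, a)\<close> at the inverse are those of Fourier inversion.\<close>

definition munit :: "nat \<Rightarrow> 'g rep \<Rightarrow> 'i \<Rightarrow> nat \<Rightarrow> nat \<Rightarrow> complex mat" where
  "munit m \<rho> i a b = msum m m
     (\<lambda>g. (of_nat (d i) / of_nat (card (carrier G)) * R i (inv g) $$ (b, a)) \<cdot>\<^sub>m \<rho> g) (carrier G)"

lemma munit_carrier [simp]: "munit m \<rho> i a b \<in> carrier_mat m m"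
  by (simp add: munit_def)

text \<open>Substituting \<open>k = g \<otimes> h\<close> moves the translation into the coefficient
  \<open>R i (h \<otimes> inv k)\<close>, which multiplicativity expands along row \<open>b\<close>
  of \<open>R i h\<close>.\<close>

lemma munit_mult_rep:
  assumes \<rho>: "representation G m \<rho>" and h: "h \<in> carrier G" and i: "i \<in> I" and ab: "a < d i" "b < d i"
  shows "munit m \<rho> i a b * \<rho> h = msum m m (\<lambda>c. R i h $$ (b, c) \<cdot>\<^sub>m munit m \<rho> i a c) {..<d i}"
proof -
  define x where "x = (of_nat (d i) / of_nat (card (carrier G)) :: complex)"
  note c = representationD(1)[OF \<rho>]
  have bij: "bij_betw (\<lambda>k. k \<otimes> inv h) (carrier G) (carrier G)"
    using h by (intro bij_betwI[where g = "\<lambda>g. g \<otimes> h"]) (auto simp: m_assoc)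
  have "munit m \<rho> i a b * \<rho> h = msum m m (\<lambda>g. (x * R i (inv g) $$ (b, a)) \<cdot>\<^sub>m \<rho> (g \<otimes> h)) (carrier G)"
    unfolding munit_def x_def[symmetric] using c h
    by (subst msum_mult[where n = m and k = m]) (auto simp: representationD(3)[OF \<rho>] intro!: msum_cong mult_smult_assoc_mat)
  also have "\<dots> = msum m m (\<lambda>k. (x * R i (h \<otimes> inv k) $$ (b, a)) \<cdot>\<^sub>m \<rho> k) (carrier G)"
    using h by (subst msum_reindex_bij[OF bij, symmetric])
      (auto simp: m_assoc inv_mult_group intro!: msum_cong)
  also have "\<dots> = msum m m (\<lambda>c. R i h $$ (b, c) \<cdot>\<^sub>m munit m \<rho> i a c) {..<d i}"
    (is "?L = ?R")
  proof (rule eq_matI)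
    fix k l assume "k < dim_row ?R" "l < dim_col ?R"
    then have kl: "k < m" "l < m" by simp_all
    have "?L $$ (k, l) = (\<Sum>g\<in>carrier G. (\<Sum>c<d i. R i h $$ (b, c) * (x * R i (inv g) $$ (c, a)) * \<rho> g $$ (k, l)))"
      unfolding index_msum[OF kl]
    proof (intro sum.cong refl)
      fix g assume g: "g \<in> carrier G"
      then show "((x * R i (h \<otimes> inv g) $$ (b, a)) \<cdot>\<^sub>m \<rho> g) $$ (k, l) =
          (\<Sum>c<d i. R i h $$ (b, c) * (x * R i (inv g) $$ (c, a)) * \<rho> g $$ (k, l))"
        using c[OF g] kl h i ab by (simp add: index_R_mult sum_distrib_left sum_distrib_right mult_ac)
    qed
    also have "\<dots> = (\<Sum>c<d i. \<Sum>g\<in>carrier G. R i h $$ (b, c) * (x * R i (inv g) $$ (c, a)) * \<rho> g $$ (k, l))"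
      by (rule sum.swap)
    also have "\<dots> = ?R $$ (k, l)"
      using kl c carrier_matD[OF c] by (simp add: index_msum munit_def x_def sum_distrib_left mult_ac)
    finally show "?L $$ (k, l) = ?R $$ (k, l)" .
  qed simp_all
  finally show ?thesis .
qed

text \<open>The mirror image: with \<open>k = h \<otimes> g\<close> the coefficient becomes
  \<open>R i (inv k \<otimes> h)\<close>, expanded along column \<open>a\<close> of
  \<open>R i h\<close>.\<close>

lemma rep_mult_munit:
  assumes \<rho>: "representation G m \<rho>" and h: "h \<in> carrier G" and i: "i \<in> I" and ab: "a < d i" "b < d i"
  shows "\<rho> h * munit m \<rho> i a b = msum m m (\<lambda>c. R i h $$ (c, a) \<cdot>\<^sub>m munit m \<rho> i c b) {..<d i}"
proof -
  define x where "x = (of_nat (d i) / of_nat (card (carrier G)) :: complex)"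
  note c = representationD(1)[OF \<rho>]
  have bij: "bij_betw (\<lambda>k. inv h \<otimes> k) (carrier G) (carrier G)"
    using h by (intro bij_betwI[where g = "\<lambda>g. h \<otimes> g"]) (auto simp: m_assoc[symmetric])
  have "\<rho> h * munit m \<rho> i a b = msum m m (\<lambda>g. (x * R i (inv g) $$ (b, a)) \<cdot>\<^sub>m \<rho> (h \<otimes> g)) (carrier G)"
    unfolding munit_def x_def[symmetric] using c h
    by (subst mult_msum[where m = m and k = m]) (auto simp: representationD(3)[OF \<rho>] intro!: msum_cong mult_smult_distrib)
  also have "\<dots> = msum m m (\<lambda>k. (x * R i (inv k \<otimes> h) $$ (b, a)) \<cdot>\<^sub>m \<rho> k) (carrier G)"
    using h by (subst msum_reindex_bij[OF bij, symmetric])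
      (auto simp: m_assoc[symmetric] inv_mult_group intro!: msum_cong)
  also have "\<dots> = msum m m (\<lambda>c. R i h $$ (c, a) \<cdot>\<^sub>m munit m \<rho> i c b) {..<d i}"
    (is "?L = ?R")
  proof (rule eq_matI)
    fix k l assume "k < dim_row ?R" "l < dim_col ?R"
    then have kl: "k < m" "l < m" by simp_all
    have "?L $$ (k, l) = (\<Sum>g\<in>carrier G. (\<Sum>c<d i. R i h $$ (c, a) * (x * R i (inv g) $$ (b, c)) * \<rho> g $$ (k, l)))"
      unfolding index_msum[OF kl]
    proof (intro sum.cong refl)
      fix g assume g: "g \<in> carrier G"
      then show "((x * R i (inv g \<otimes> h) $$ (b, a)) \<cdot>\<^sub>m \<rho> g) $$ (k, l) =
          (\<Sum>c<d i. R i h $$ (c, a) * (x * R i (inv g) $$ (b, c)) * \<rho> g $$ (k, l))"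
        using c[OF g] kl h i ab by (simp add: index_R_mult sum_distrib_left sum_distrib_right mult_ac)
    qed
    also have "\<dots> = (\<Sum>c<d i. \<Sum>g\<in>carrier G. R i h $$ (c, a) * (x * R i (inv g) $$ (b, c)) * \<rho> g $$ (k, l))"
      by (rule sum.swap)
    also have "\<dots> = ?R $$ (k, l)"
      using kl c carrier_matD[OF c] by (simp add: index_msum munit_def x_def sum_distrib_left mult_ac)
    finally show "?L $$ (k, l) = ?R $$ (k, l)" .
  qed simp_all
  finally show ?thesis .
qed

text \<open>Write the second factor as a sum over the group and absorb each \<open>\<rho> g\<close>
  into the first factor; the scalars that accumulate are exactly the sums of
  \<open>schur_orthogonality\<close>.\<close>

lemma munit_mult_munit:
  assumes \<rho>: "representation G m \<rho>" and ij: "i \<in> I" "j \<in> I"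
    and lt: "a < d i" "b < d i" "c < d j" "e < d j"
  shows "munit m \<rho> i a b * munit m \<rho> j c e = of_bool (i = j \<and> b = c) \<cdot>\<^sub>m munit m \<rho> i a e"
proof -
  define k where "k g = of_nat (d j) / of_nat (card (carrier G)) * R j (inv g) $$ (e, c)" for g
  have "munit m \<rho> i a b * munit m \<rho> j c e = msum m m (\<lambda>g. k g \<cdot>\<^sub>m (munit m \<rho> i a b * \<rho> g)) (carrier G)"
    unfolding munit_def[of m \<rho> j] k_def[symmetric] using representationD(1)[OF \<rho>]
    by (subst mult_msum[where m = m and k = m])
      (auto intro!: msum_cong mult_smult_distrib[where nr = m and n = m and nc = m])
  also have "\<dots> = msum m m (\<lambda>g. msum m m (\<lambda>f. (k g * R i g $$ (b, f)) \<cdot>\<^sub>m munit m \<rho> i a f) {..<d i}) (carrier G)"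
  proof (intro msum_cong)
    fix g assume g: "g \<in> carrier G"
    show "k g \<cdot>\<^sub>m (munit m \<rho> i a b * \<rho> g) = msum m m (\<lambda>f. (k g * R i g $$ (b, f)) \<cdot>\<^sub>m munit m \<rho> i a f) {..<d i}"
      using munit_mult_rep[OF \<rho> g ij(1) lt(1,2)]
      by (simp add: smult_msum smult_smult_mat)
  qed
  also have "\<dots> = msum m m (\<lambda>f. (\<Sum>g\<in>carrier G. k g * R i g $$ (b, f)) \<cdot>\<^sub>m munit m \<rho> i a f) {..<d i}"
    by (subst msum_swap) (simp add: msum_smult)
  also have "\<dots> = msum m m (\<lambda>f. of_bool (i = j \<and> b = c \<and> f = e) \<cdot>\<^sub>m munit m \<rho> i a f) {..<d i}"
  proof (intro msum_cong)
    fix f assume "f \<in> {..<d i}"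
    then have "(\<Sum>g\<in>carrier G. k g * R i g $$ (b, f)) = of_bool (i = j \<and> b = c \<and> f = e)"
      unfolding k_def using ij lt by (intro schur_orthogonality) auto
    then show "(\<Sum>g\<in>carrier G. k g * R i g $$ (b, f)) \<cdot>\<^sub>m munit m \<rho> i a f =
        of_bool (i = j \<and> b = c \<and> f = e) \<cdot>\<^sub>m munit m \<rho> i a f" by simp
  qed
  also have "\<dots> = of_bool (i = j \<and> b = c) \<cdot>\<^sub>m munit m \<rho> i a e"
  proof (cases "i = j \<and> b = c")
    case True
    then show ?thesis using lt by (simp add: msum_delta one_smult_mat)
  next
    case False
    have "msum m m (\<lambda>f. 0 \<cdot>\<^sub>m munit m \<rho> i a f) {..<d i} = 0 \<cdot>\<^sub>m munit m \<rho> i a e"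
      using carrier_matD[OF munit_carrier] by (intro eq_matI) (simp_all add: index_msum)
    moreover have "of_bool (i = j \<and> b = c) = (0::complex)" "\<And>f. of_bool (i = j \<and> b = c \<and> f = e) = (0::complex)"
      using False by auto
    ultimately show ?thesis by (simp only:)
  qed
  finally show ?thesis .
qed

text \<open>The total coefficient of \<open>\<rho> g\<close> is the regular character at
  \<open>inv g\<close> divided by the group order, so only the identity survives.\<close>

lemma msum_munit:
  assumes \<rho>: "representation G m \<rho>"
  shows "msum m m (\<lambda>i. msum m m (\<lambda>a. munit m \<rho> i a a) {..<d i}) I = 1\<^sub>m m"
    (is "?L = _")
proof -
  define n where "n = (of_nat (card (carrier G)) :: complex)"
  have n: "n \<noteq> 0" using finite_carrier by (auto simp: n_def)
  note c = representationD(1)[OF \<rho>]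
  have "?L = \<rho> \<one>"
  proof (rule eq_matI)
    fix k l assume "k < dim_row (\<rho> \<one>)" "l < dim_col (\<rho> \<one>)"
    then have kl: "k < m" "l < m" using c[of \<one>] by simp_all
    have "?L $$ (k, l) = (\<Sum>i\<in>I. \<Sum>a<d i. \<Sum>g\<in>carrier G. of_nat (d i) / n * R i (inv g) $$ (a, a) * \<rho> g $$ (k, l))"
      using kl c carrier_matD[OF c] by (simp add: index_msum munit_def n_def)
    also have "\<dots> = (\<Sum>i\<in>I. \<Sum>g\<in>carrier G. of_nat (d i) / n * mtrace (R i (inv g)) * \<rho> g $$ (k, l))"
    proof (rule sum.cong[OF refl])
      fix i assume i: "i \<in> I"
      have "mtrace (R i (inv g)) = (\<Sum>a<d i. R i (inv g) $$ (a, a))" if "g \<in> carrier G" for g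
        using R_carrier[OF i, of "inv g"] that by (simp add: mtrace_def)
      then show "(\<Sum>a<d i. \<Sum>g\<in>carrier G. of_nat (d i) / n * R i (inv g) $$ (a, a) * \<rho> g $$ (k, l)) =
          (\<Sum>g\<in>carrier G. of_nat (d i) / n * mtrace (R i (inv g)) * \<rho> g $$ (k, l))"
        by (subst sum.swap) (simp add: sum_distrib_left sum_distrib_right)
    qed
    also have "\<dots> = (\<Sum>g\<in>carrier G. (\<Sum>i\<in>I. of_nat (d i) * mtrace (R i (inv g))) / n * \<rho> g $$ (k, l))"
      by (subst sum.swap) (simp add: sum_distrib_right sum_divide_distrib)
    also have "\<dots> = (\<Sum>g\<in>carrier G. if g = \<one> then \<rho> g $$ (k, l) else 0)"
      using n by (intro sum.cong refl) (simp add: regular n_def inv_eq_1_iff)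
    also have "\<dots> = \<rho> \<one> $$ (k, l)"
      using finite_carrier by simp
    finally show "?L $$ (k, l) = \<rho> \<one> $$ (k, l)" .
  qed (use c[of \<one>] in simp_all)
  then show ?thesis by (simp add: representationD(2)[OF \<rho>])
qed

text \<open>Multiply \<open>\<rho> g\<close> by the resolution of the identity into diagonal matrix
  units and take traces.\<close>

lemma character_decomposition:
  assumes \<rho>: "representation G m \<rho>" and g: "g \<in> carrier G"
  shows "mtrace (\<rho> g) = (\<Sum>i\<in>I. mtrace (munit m \<rho> i 0 0) * mtrace (R i g))"
proof -
  define t where "t i = mtrace (munit m \<rho> i 0 0)" for i
  \<comment> \<open>The unit \<open>(c, a)\<close> is the product of \<open>(c, 0)\<close> and
    \<open>(0, a)\<close>; cyclicity of the trace reverses the factors and leaves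
    \<open>(0, 0)\<close> or zero.\<close>
  have tr: "mtrace (munit m \<rho> i c a) = of_bool (c = a) * t i"
    if i: "i \<in> I" "c < d i" "a < d i" for i c a
  proof -
    have "mtrace (munit m \<rho> i c a) = mtrace (munit m \<rho> i c 0 * munit m \<rho> i 0 a)"
      using that d_pos by (simp add: munit_mult_munit[OF \<rho>] one_smult_mat)
    also have "\<dots> = mtrace (munit m \<rho> i 0 a * munit m \<rho> i c 0)"
      by (rule mtrace_mult_comm[OF munit_carrier munit_carrier])
    also have "\<dots> = of_bool (c = a) * t i"
      using that d_pos by (auto simp: t_def munit_mult_munit[OF \<rho>] mtrace_smult[OF munit_carrier])
    finally show ?thesis .
  qed
  note c = representationD(1)[OF \<rho> g]
  have "\<rho> g = \<rho> g * msum m m (\<lambda>i. msum m m (\<lambda>a. munit m \<rho> i a a) {..<d i}) I"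
    using c by (simp add: msum_munit[OF \<rho>])
  also have "\<dots> = msum m m (\<lambda>i. msum m m (\<lambda>a. \<rho> g * munit m \<rho> i a a) {..<d i}) I"
    using c by (simp add: mult_msum[where m = m and k = m])
  also have "\<dots> = msum m m (\<lambda>i. msum m m (\<lambda>a. msum m m (\<lambda>c. R i g $$ (c, a) \<cdot>\<^sub>m munit m \<rho> i c a) {..<d i}) {..<d i}) I"
    using g by (intro msum_cong) (simp add: rep_mult_munit[OF \<rho>])
  finally have "mtrace (\<rho> g) = (\<Sum>i\<in>I. \<Sum>a<d i. \<Sum>c<d i. R i g $$ (c, a) * mtrace (munit m \<rho> i c a))"
    by (simp add: mtrace_msum mtrace_smult[OF munit_carrier])
  also have "\<dots> = (\<Sum>i\<in>I. \<Sum>a<d i. \<Sum>c<d i. if c = a then R i g $$ (c, a) * t i else 0)"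
    by (intro sum.cong refl) (simp add: tr)
  also have "\<dots> = (\<Sum>i\<in>I. t i * mtrace (R i g))"
    by (intro sum.cong refl) (simp add: mtrace_eq_sum[OF R_carrier[OF _ g]] sum_distrib_left mult_ac)
  finally show ?thesis by (simp add: t_def)
qed

lemma munit_idempotent:
  "representation G m \<rho> \<Longrightarrow> i \<in> I \<Longrightarrow> munit m \<rho> i 0 0 * munit m \<rho> i 0 0 = munit m \<rho> i 0 0"
  using d_pos by (simp add: munit_mult_munit one_smult_mat)

text \<open>The complex coefficients of \<open>character_decomposition\<close> are traces of
  idempotents, hence ranks.\<close>

lemma character_multiplicities:
  assumes \<rho>: "representation G m \<rho>"
  obtains n :: "'i \<Rightarrow> nat"
  where "\<And>g. g \<in> carrier G \<Longrightarrow> mtrace (\<rho> g) = (\<Sum>i\<in>I. of_nat (n i) * mtrace (R i g))"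
proof -
  have "\<exists>r. mtrace (munit m \<rho> i 0 0) = of_nat r" if "i \<in> I" for i
    by (rule idempotent_mat_factorization[OF munit_carrier munit_idempotent[OF \<rho> that]]) blast
  then obtain n where "\<And>i. i \<in> I \<Longrightarrow> mtrace (munit m \<rho> i 0 0) = of_nat (n i)" by metis
  then show thesis by (intro that[of n]) (simp add: character_decomposition[OF \<rho>])
qed

text \<open>Intertwiners from \<open>\<rho>\<close> to \<open>\<sigma>\<close> correspond to linear maps between the images of
  \<open>munit \<rho> i 0 0\<close> and \<open>munit \<sigma> i 0 0\<close>, one for each \<open>i\<close>; this is the intertwiner built from a family
  of such maps.\<close>

definition intertwiner :: "nat \<Rightarrow> 'g rep \<Rightarrow> 'g rep \<Rightarrow> ('i \<Rightarrow> complex mat) \<Rightarrow> complex mat" where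
  "intertwiner m \<rho> \<sigma> A =
     msum m m (\<lambda>i. msum m m (\<lambda>a. munit m \<sigma> i a 0 * A i * munit m \<rho> i 0 a) {..<d i}) I"

lemma intertwiner_carrier [simp]: "intertwiner m \<rho> \<sigma> A \<in> carrier_mat m m"
  by (simp add: intertwiner_def)

text \<open>Multiplying by \<open>\<rho> g\<close> on the right expands the second unit with
  coefficients \<open>R i g\<close>; multiplying by \<open>\<sigma> g\<close> on the left expands
  the first unit with the same coefficients. The two double sums differ by exchanging the summation
  indices.\<close>

lemma intertwiner_commute:
  assumes \<rho>: "representation G m \<rho>" and \<sigma>: "representation G m \<sigma>" and g: "g \<in> carrier G"
    and A: "\<And>i. i \<in> I \<Longrightarrow> A i \<in> carrier_mat m m"
  shows "intertwiner m \<rho> \<sigma> A * \<rho> g = \<sigma> g * intertwiner m \<rho> \<sigma> A"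
proof -
  note c = representationD(1)[OF \<rho> g] representationD(1)[OF \<sigma> g]
  have "intertwiner m \<rho> \<sigma> A * \<rho> g =
      msum m m (\<lambda>i. msum m m (\<lambda>a. munit m \<sigma> i a 0 * A i * (munit m \<rho> i 0 a * \<rho> g)) {..<d i}) I"
    unfolding intertwiner_def using c A
    by (subst msum_mult[where n = m and k = m])
      (auto simp: msum_mult[where n = m and k = m] assoc_mult_mat[where ?n\<^sub>1 = m and ?n\<^sub>2 = m and ?n\<^sub>3 = m and ?n\<^sub>4 = m]
        mult_carrier_mat[where n = m] intro!: msum_cong)
  also have "\<dots> = msum m m (\<lambda>i. msum m m (\<lambda>a. msum m m (\<lambda>b. R i g $$ (a, b) \<cdot>\<^sub>m
      (munit m \<sigma> i a 0 * A i * munit m \<rho> i 0 b)) {..<d i}) {..<d i}) I"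
  proof (intro msum_cong)
    fix i a assume i: "i \<in> I" and a: "a \<in> {..<d i}"
    have UA: "munit m \<sigma> i a 0 * A i \<in> carrier_mat m m" using A[OF i] by (intro mult_carrier_mat[where n = m]) simp_all
    show "munit m \<sigma> i a 0 * A i * (munit m \<rho> i 0 a * \<rho> g) = msum m m (\<lambda>b. R i g $$ (a, b) \<cdot>\<^sub>m
        (munit m \<sigma> i a 0 * A i * munit m \<rho> i 0 b)) {..<d i}"
      using i a UA d_pos g
      by (simp add: munit_mult_rep[OF \<rho>] mult_msum[where m = m and k = m] mult_smult_distrib[OF UA munit_carrier])
  qed
  also have "\<dots> = msum m m (\<lambda>i. msum m m (\<lambda>a. msum m m (\<lambda>b. R i g $$ (b, a) \<cdot>\<^sub>m
      (munit m \<sigma> i b 0 * A i * munit m \<rho> i 0 a)) {..<d i}) {..<d i}) I"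
    by (intro msum_cong msum_swap)
  also have "\<dots> = msum m m (\<lambda>i. msum m m (\<lambda>a. \<sigma> g * munit m \<sigma> i a 0 * (A i * munit m \<rho> i 0 a)) {..<d i}) I"
  proof (intro msum_cong)
    fix i a assume i: "i \<in> I" and a: "a \<in> {..<d i}"
    have AU: "A i * munit m \<rho> i 0 a \<in> carrier_mat m m" using A[OF i] by (intro mult_carrier_mat[where n = m]) simp_all
    show "msum m m (\<lambda>b. R i g $$ (b, a) \<cdot>\<^sub>m (munit m \<sigma> i b 0 * A i * munit m \<rho> i 0 a)) {..<d i} =
        \<sigma> g * munit m \<sigma> i a 0 * (A i * munit m \<rho> i 0 a)"
      using i a AU d_pos g A[OF i]
      by (simp add: rep_mult_munit[OF \<sigma>] msum_mult[where n = m and k = m] mult_smult_assoc_mat[OF munit_carrier AU]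
          assoc_mult_mat[OF munit_carrier A[OF i] munit_carrier])
  qed
  also have "\<dots> = \<sigma> g * intertwiner m \<rho> \<sigma> A"
    unfolding intertwiner_def using c A
    by (subst mult_msum[where m = m and k = m])
      (auto simp: mult_msum[where m = m and k = m] assoc_mult_mat[where ?n\<^sub>1 = m and ?n\<^sub>2 = m and ?n\<^sub>3 = m and ?n\<^sub>4 = m]
        mult_carrier_mat[where n = m] intro!: msum_cong)
  finally show ?thesis .
qed

text \<open>In a product of two terms the inner units of \<open>\<sigma>\<close> meet and vanish
  unless block and index agree; the surviving terms are the diagonal units of \<open>\<rho>\<close>,
  which add up to the identity.\<close>

lemma intertwiner_inverse:
  assumes \<rho>: "representation G m \<rho>" and \<sigma>: "representation G m \<sigma>"
    and A: "\<And>i. i \<in> I \<Longrightarrow> A i \<in> carrier_mat m m" and B: "\<And>i. i \<in> I \<Longrightarrow> B i \<in> carrier_mat m m"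
    and BA: "\<And>i. i \<in> I \<Longrightarrow> B i * A i = munit m \<rho> i 0 0"
    and UA: "\<And>i. i \<in> I \<Longrightarrow> munit m \<sigma> i 0 0 * A i = A i"
  shows "intertwiner m \<sigma> \<rho> B * intertwiner m \<rho> \<sigma> A = 1\<^sub>m m"
proof -
  note assoc = assoc_mult_mat[where ?n\<^sub>1 = m and ?n\<^sub>2 = m and ?n\<^sub>3 = m and ?n\<^sub>4 = m]
  \<comment> \<open>The range of \<open>b\<close> depends on \<open>j\<close>, so the two deltas are
    kept apart: \<open>msum_delta\<close> collapses the sum over \<open>j\<close> before the one
    over \<open>b\<close>.\<close>
  have prod: "munit m \<rho> i a 0 * B i * munit m \<sigma> i 0 a * (munit m \<sigma> j b 0 * A j * munit m \<rho> j 0 b) =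
      of_bool (j = i) \<cdot>\<^sub>m (of_bool (b = a) \<cdot>\<^sub>m munit m \<rho> i a a)" (is "?L = ?R")
    if ij: "i \<in> I" "j \<in> I" and ab: "a < d i" "b < d j" for i j a b
  proof -
    have "?L = munit m \<rho> i a 0 * B i * ((munit m \<sigma> i 0 a * munit m \<sigma> j b 0) * (A j * munit m \<rho> j 0 b))"
      using A[OF ij(2)] B[OF ij(1)] by (simp add: assoc mult_carrier_mat[where n = m])
    also have "\<dots> = of_bool (i = j \<and> a = b) \<cdot>\<^sub>m
        (munit m \<rho> i a 0 * B i * (munit m \<sigma> i 0 0 * (A j * munit m \<rho> j 0 b)))"
      using A[OF ij(2)] B[OF ij(1)] ij ab d_pos
      by (simp add: munit_mult_munit[OF \<sigma>] mult_smult_assoc_mat[where nr = m and n = m and nc = m]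
          mult_smult_distrib[where nr = m and n = m and nc = m] mult_carrier_mat[where n = m])
    also have "\<dots> = ?R"
    proof (cases "i = j \<and> a = b")
      case True
      have "munit m \<rho> i a 0 * B i * (munit m \<sigma> i 0 0 * (A i * munit m \<rho> i 0 a)) =
          munit m \<rho> i a 0 * (B i * (munit m \<sigma> i 0 0 * A i)) * munit m \<rho> i 0 a"
        using A[OF ij(1)] B[OF ij(1)] by (simp add: assoc mult_carrier_mat[where n = m])
      also have "\<dots> = munit m \<rho> i a a"
        using ij ab d_pos by (simp add: UA BA munit_mult_munit[OF \<rho>] one_smult_mat)
      finally show ?thesis using True by (simp add: one_smult_mat)
    next
      case False
      then show ?thesis
        using A[OF ij(2)] B[OF ij(1)] carrier_matD[OF munit_carrier] by (intro eq_matI) auto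
    qed
    finally show ?thesis .
  qed
  have L: "munit m \<rho> i a 0 * B i * munit m \<sigma> i 0 a \<in> carrier_mat m m" if "i \<in> I" for i a
    using B[OF that] by (intro mult_carrier_mat[where n = m]) simp_all
  have "intertwiner m \<sigma> \<rho> B * intertwiner m \<rho> \<sigma> A = msum m m (\<lambda>i. msum m m (\<lambda>a.
      munit m \<rho> i a 0 * B i * munit m \<sigma> i 0 a * intertwiner m \<rho> \<sigma> A) {..<d i}) I"
    unfolding intertwiner_def[of m \<sigma> \<rho>] using L
    by (simp add: msum_mult[where n = m and k = m] cong: msum_cong)
  also have "\<dots> =
      msum m m (\<lambda>i. msum m m (\<lambda>a. msum m m (\<lambda>j. msum m m (\<lambda>b.
        munit m \<rho> i a 0 * B i * munit m \<sigma> i 0 a * (munit m \<sigma> j b 0 * A j * munit m \<rho> j 0 b))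
        {..<d j}) I) {..<d i}) I"
    unfolding intertwiner_def using A L
    by (simp add: mult_msum[where m = m and k = m] mult_carrier_mat[where n = m] cong: msum_cong)
  also have "\<dots> = msum m m (\<lambda>i. msum m m (\<lambda>a. munit m \<rho> i a a) {..<d i}) I"
  proof (intro msum_cong)
    fix i a assume i: "i \<in> I" and a: "a \<in> {..<d i}"
    have "msum m m (\<lambda>j. msum m m (\<lambda>b. munit m \<rho> i a 0 * B i * munit m \<sigma> i 0 a *
        (munit m \<sigma> j b 0 * A j * munit m \<rho> j 0 b)) {..<d j}) I =
        msum m m (\<lambda>j. of_bool (j = i) \<cdot>\<^sub>m msum m m (\<lambda>b. of_bool (b = a) \<cdot>\<^sub>m munit m \<rho> i a a) {..<d j}) I"
    proof (rule msum_cong)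
      fix j assume j: "j \<in> I"
      show "msum m m (\<lambda>b. munit m \<rho> i a 0 * B i * munit m \<sigma> i 0 a *
          (munit m \<sigma> j b 0 * A j * munit m \<rho> j 0 b)) {..<d j} =
          of_bool (j = i) \<cdot>\<^sub>m msum m m (\<lambda>b. of_bool (b = a) \<cdot>\<^sub>m munit m \<rho> i a a) {..<d j}"
        using i j a by (subst smult_msum) (simp, rule msum_cong, rule prod, simp_all)
    qed
    also have "\<dots> = msum m m (\<lambda>b. of_bool (b = a) \<cdot>\<^sub>m munit m \<rho> i a a) {..<d i}"
      using finite_I i by (rule msum_delta) simp
    also have "\<dots> = munit m \<rho> i a a"
      using a msum_delta[of "{..<d i}" a "\<lambda>_. munit m \<rho> i a a" m m] by simp
    finally show "msum m m (\<lambda>j. msum m m (\<lambda>b. munit m \<rho> i a 0 * B i * munit m \<sigma> i 0 a *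
        (munit m \<sigma> j b 0 * A j * munit m \<rho> j 0 b)) {..<d j}) I = munit m \<rho> i a a" .
  qed
  also have "\<dots> = 1\<^sub>m m" by (rule msum_munit[OF \<rho>])
  finally show ?thesis .
qed

text \<open>The value at the identity gives equal degrees, and independence gives equal traces of
  the idempotents \<open>munit m \<rho> i 0 0\<close> and \<open>munit m \<sigma> i 0 0\<close>.
  Their images then have equal dimension.\<close>

theorem rep_iso_iff_characters:
  assumes \<rho>: "\<rho> \<in> reps G" and \<sigma>: "\<sigma> \<in> reps G"
  shows "rep_iso G \<rho> \<sigma> \<longleftrightarrow> (\<forall>g\<in>carrier G. mtrace (\<rho> g) = mtrace (\<sigma> g))"
proof
  assume eq: "\<forall>g\<in>carrier G. mtrace (\<rho> g) = mtrace (\<sigma> g)"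
  obtain m k where \<rho>: "representation G m \<rho>" and "representation G k \<sigma>"
    using \<rho> \<sigma> by (auto simp: reps_def)
  moreover have "k = m"
    using eq[rule_format, of \<one>] calculation by (simp add: representationD(2) mtrace_one)
  ultimately have \<sigma>: "representation G m \<sigma>" by simp
  have tr: "mtrace (munit m \<rho> i 0 0) = mtrace (munit m \<sigma> i 0 0)" if i: "i \<in> I" for i
  proof -
    have "mtrace (munit m \<rho> i 0 0) - mtrace (munit m \<sigma> i 0 0) = 0"
    proof (rule characters_independent[OF _ i])
      fix g assume g: "g \<in> carrier G"
      show "(\<Sum>i\<in>I. (mtrace (munit m \<rho> i 0 0) - mtrace (munit m \<sigma> i 0 0)) * mtrace (R i g)) = 0"
        using eq g character_decomposition[OF \<rho> g] character_decomposition[OF \<sigma> g]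
        by (simp add: left_diff_distrib sum_subtractf)
    qed
    then show ?thesis by simp
  qed
  have "\<forall>i\<in>I. \<exists>A B. A \<in> carrier_mat m m \<and> B \<in> carrier_mat m m \<and> B * A = munit m \<rho> i 0 0 \<and> A * B = munit m \<sigma> i 0 0 \<and>
      munit m \<sigma> i 0 0 * A = A \<and> munit m \<rho> i 0 0 * B = B"
  proof
    fix i assume i: "i \<in> I"
    obtain r V W where 1: "V \<in> carrier_mat m r" "W \<in> carrier_mat r m" "V * W = munit m \<rho> i 0 0"
        "W * V = 1\<^sub>m r" "mtrace (munit m \<rho> i 0 0) = of_nat r"
      by (rule idempotent_mat_factorization[OF munit_carrier munit_idempotent[OF \<rho> i]])
    obtain s V' W' where 2: "V' \<in> carrier_mat m s" "W' \<in> carrier_mat s m" "V' * W' = munit m \<sigma> i 0 0"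
        "W' * V' = 1\<^sub>m s" "mtrace (munit m \<sigma> i 0 0) = of_nat s"
      by (rule idempotent_mat_factorization[OF munit_carrier munit_idempotent[OF \<sigma> i]])
    have "r = s" using 1(5) 2(5) tr[OF i] by simp
    have cancel: "(X * Y) * (Y' * Z) = X * Z"
      if "X \<in> carrier_mat m r" "Y \<in> carrier_mat r m" "Y' \<in> carrier_mat m r" "Z \<in> carrier_mat r m"
        "Y * Y' = 1\<^sub>m r" for X Y Y' Z :: "complex mat"
    proof -
      have "(X * Y) * (Y' * Z) = X * ((Y * Y') * Z)"
        using that assoc_mult_mat[of X m r Y m "Y' * Z" m] assoc_mult_mat[of Y r m Y' r Z m] by auto
      then show ?thesis using that by simp
    qed
    \<comment> \<open>Both images are identified with the same coordinate space, so
      \<open>V' * W\<close> leads from one to the other and \<open>V * W'\<close> back.\<close>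
    show "\<exists>A B. A \<in> carrier_mat m m \<and> B \<in> carrier_mat m m \<and> B * A = munit m \<rho> i 0 0 \<and> A * B = munit m \<sigma> i 0 0 \<and>
      munit m \<sigma> i 0 0 * A = A \<and> munit m \<rho> i 0 0 * B = B"
      using 1(1-4) 2(1-4) \<open>r = s\<close>
      by (intro exI[of _ "V' * W"] exI[of _ "V * W'"]) (auto simp: cancel simp flip: 1(3) 2(3))
  qed
  from bchoice[OF this] obtain A where "\<forall>i\<in>I. \<exists>B. A i \<in> carrier_mat m m \<and> B \<in> carrier_mat m m \<and> B * A i = munit m \<rho> i 0 0 \<and> A i * B = munit m \<sigma> i 0 0 \<and>
      munit m \<sigma> i 0 0 * A i = A i \<and> munit m \<rho> i 0 0 * B = B"
    by blast
  from bchoice[OF this] obtain B where AB: "\<forall>i\<in>I. A i \<in> carrier_mat m m \<and> B i \<in> carrier_mat m m \<and> B i * A i = munit m \<rho> i 0 0 \<and> A i * B i = munit m \<sigma> i 0 0 \<and>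
      munit m \<sigma> i 0 0 * A i = A i \<and> munit m \<rho> i 0 0 * B i = B i"
    by blast
  let ?P = "intertwiner m \<rho> \<sigma> A" and ?Q = "intertwiner m \<sigma> \<rho> B"
  have "?Q * ?P = 1\<^sub>m m" "?P * ?Q = 1\<^sub>m m"
    using AB \<rho> \<sigma> by (auto intro!: intertwiner_inverse)
  then have "invertible_mat ?P"
    unfolding invertible_mat_def inverts_mat_def
    using carrier_matD[OF intertwiner_carrier] by auto
  then show "rep_iso G \<rho> \<sigma>"
    unfolding rep_iso_def using \<rho> \<sigma> AB intertwiner_commute by (intro exI[of _ m] exI[of _ ?P]) auto
qed (auto intro: mtrace_rep_iso)

end

section \<open>Integer combinations\<close>

lemma additive_add_pow_int:
  fixes h :: "'a \<Rightarrow> 'b::ring_1" and k :: int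
  assumes "abelian_group M" and add: "\<And>x y. x \<in> carrier M \<Longrightarrow> y \<in> carrier M \<Longrightarrow> h (x \<oplus>\<^bsub>M\<^esub> y) = h x + h y"
    and x: "x \<in> carrier M"
  shows "h ([k] \<cdot>\<^bsub>M\<^esub> x) = of_int k * h x"
proof -
  interpret abelian_group M by fact
  have zero: "h \<zero>\<^bsub>M\<^esub> = 0"
    using add[of "\<zero>\<^bsub>M\<^esub>" "\<zero>\<^bsub>M\<^esub>"] by simp
  have inv: "h (\<ominus>\<^bsub>M\<^esub> y) = - h y" if "y \<in> carrier M" for y
    using add[of y "\<ominus>\<^bsub>M\<^esub> y"] that zero by (simp add: r_neg eq_neg_iff_add_eq_0 add.commute)
  have nat: "h ([n] \<cdot>\<^bsub>M\<^esub> x) = of_nat n * h x" for n :: nat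
    using x by (induction n) (simp_all add: zero add distrib_right add.commute)
  show ?thesis
  proof (cases "k \<ge> 0")
    case True
    then show ?thesis using nat[of "nat k"] by (simp add: add_pow_int_ge)
  next
    case False
    then have "h ([k] \<cdot>\<^bsub>M\<^esub> x) = - (of_nat (nat (- k)) * h x)"
      using nat[of "nat (- k)"] inv x by (simp add: add_pow_int_lt)
    also have "(of_nat (nat (- k)) :: 'b) = - of_int k"
      using False by (simp add: of_nat_nat)
    finally show ?thesis by simp
  qed
qed

text \<open>Stated for plain functions into a ring, so that it serves both for the character value
  at a fixed group element and for integer-valued maps.\<close>

lemma additive_zcomb:
  fixes h :: "'a \<Rightarrow> 'b::ring_1"
  assumes M: "abelian_group M" and add: "\<And>x y. x \<in> carrier M \<Longrightarrow> y \<in> carrier M \<Longrightarrow> h (x \<oplus>\<^bsub>M\<^esub> y) = h x + h y"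
    and X: "finite X" "X \<subseteq> carrier M"
  shows "h (zcomb M X c) = (\<Sum>x\<in>X. of_int (c x) * h x)"
proof -
  interpret abelian_group M by fact
  have zero: "h \<zero>\<^bsub>M\<^esub> = 0"
    using add[of "\<zero>\<^bsub>M\<^esub>" "\<zero>\<^bsub>M\<^esub>"] by simp
  show ?thesis
    unfolding zcomb_def using X
  proof (induction X rule: finite_induct)
    case (insert x X)
    then have "(\<lambda>x. [c x] \<cdot>\<^bsub>M\<^esub> x) \<in> X \<rightarrow> carrier M" "[c x] \<cdot>\<^bsub>M\<^esub> x \<in> carrier M" by auto
    with insert show ?case by (simp add: add additive_add_pow_int[OF M add])
  qed (simp add: zero)
qed

lemma zcomb_closed:
  assumes "abelian_group M" "X \<subseteq> carrier M"
  shows "zcomb M X c \<in> carrier M"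
proof -
  interpret abelian_group M by fact
  show ?thesis unfolding zcomb_def using assms(2) by (intro finsum_closed) auto
qed

lemma zcomb_zcoord:
  assumes "z_basis M X" "m \<in> carrier M"
  shows "zcomb M X (zcoord M X m) = m"
proof -
  have "\<exists>!c. c \<in> X \<rightarrow>\<^sub>E UNIV \<and> m = zcomb M X c" using assms by (auto simp: z_basis_def)
  from theI'[OF this] show ?thesis by (simp add: zcoord_def)
qed

lemma zcoord_eqI:
  assumes "z_basis M X" "m \<in> carrier M" "c \<in> X \<rightarrow>\<^sub>E UNIV" "m = zcomb M X c"
  shows "zcoord M X m = c"
proof -
  have "\<exists>!c. c \<in> X \<rightarrow>\<^sub>E UNIV \<and> m = zcomb M X c" using assms by (auto simp: z_basis_def)
  then show ?thesis unfolding zcoord_def using assms by (intro the1_equality) auto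
qed

section \<open>Characters of virtual representations\<close>

definition vchar :: "'g rep \<times> 'g rep \<Rightarrow> 'g \<Rightarrow> complex" where
  "vchar p g = mtrace (fst p g) - mtrace (snd p g)"

text \<open>The choice of representative is immaterial on \<open>carrier G\<close>, by
  \<open>class_char_eq\<close>; elsewhere representatives of one class may differ.\<close>

definition class_char :: "'g virtual \<Rightarrow> 'g \<Rightarrow> complex" where
  "class_char A = vchar (SOME p. p \<in> A)"

lemma dsum_in_reps: "\<rho> \<in> reps G \<Longrightarrow> \<sigma> \<in> reps G \<Longrightarrow> dsum_rep \<rho> \<sigma> \<in> reps G"
  by (auto simp: reps_def dest: representation_dsum)

lemma tensor_in_reps: "\<rho> \<in> reps G \<Longrightarrow> \<sigma> \<in> reps G \<Longrightarrow> tensor_rep \<rho> \<sigma> \<in> reps G"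
  by (auto simp: reps_def dest: representation_tensor)

lemma zero_in_reps: "zero_rep \<in> reps G"
  using representation_zero by (auto simp: reps_def)

lemma trivial_in_reps: "trivial_rep \<in> reps G"
  using representation_trivial by (auto simp: reps_def)

context regular_family
begin

section \<open>Virtual representations as functions on the group\<close>

lemma mtrace_dsum_reps:
  "\<rho> \<in> reps G \<Longrightarrow> \<sigma> \<in> reps G \<Longrightarrow> g \<in> carrier G \<Longrightarrow> mtrace (dsum_rep \<rho> \<sigma> g) = mtrace (\<rho> g) + mtrace (\<sigma> g)"
  by (auto simp: reps_def mtrace_dsum)

lemma mtrace_tensor_reps:
  "\<rho> \<in> reps G \<Longrightarrow> \<sigma> \<in> reps G \<Longrightarrow> g \<in> carrier G \<Longrightarrow> mtrace (tensor_rep \<rho> \<sigma> g) = mtrace (\<rho> g) * mtrace (\<sigma> g)"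
  by (auto simp: reps_def mtrace_tensor)

text \<open>The trace of \<open>\<tau>\<close> cancels, so the isomorphism condition is the same for
  every \<open>\<tau>\<close>, and \<open>zero_rep\<close> witnesses existence.\<close>

lemma virtual_eq_iff:
  "(p, q) \<in> virtual_eq G \<longleftrightarrow>
     p \<in> reps G \<times> reps G \<and> q \<in> reps G \<times> reps G \<and> (\<forall>g\<in>carrier G. vchar p g = vchar q g)"
proof -
  obtain \<rho> \<sigma> \<rho>' \<sigma>' where pq: "p = (\<rho>, \<sigma>)" "q = (\<rho>', \<sigma>')" by (cases p, cases q)
  have "rep_iso G (dsum_rep (dsum_rep \<rho> \<sigma>') \<tau>) (dsum_rep (dsum_rep \<rho>' \<sigma>) \<tau>) \<longleftrightarrow>
      (\<forall>g\<in>carrier G. vchar p g = vchar q g)"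
    if "\<rho> \<in> reps G" "\<sigma> \<in> reps G" "\<rho>' \<in> reps G" "\<sigma>' \<in> reps G" "\<tau> \<in> reps G" for \<tau>
    using that
    by (simp add: rep_iso_iff_characters dsum_in_reps mtrace_dsum_reps pq vchar_def algebra_simps)
  then show ?thesis
    using zero_in_reps[of G] by (auto simp: virtual_eq_def pq)
qed

lemma equiv_virtual_eq: "equiv (reps G \<times> reps G) (virtual_eq G)"
  by (rule equivI) (auto simp: refl_on_def sym_def trans_def virtual_eq_iff)

abbreviation (input) "K \<equiv> representation_ring G"

lemma carrier_K: "carrier K = (reps G \<times> reps G) // virtual_eq G"
  by (simp add: representation_ring_def)

lemma class_char_eq:
  assumes "A \<in> carrier K" "p \<in> A" "g \<in> carrier G"
  shows "class_char A g = vchar p g"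
proof -
  have "(SOME p. p \<in> A) \<in> A" using assms(2) by (rule someI)
  then have "((SOME p. p \<in> A), p) \<in> virtual_eq G"
    using assms quotient_eq_iff[OF equiv_virtual_eq, of A A "SOME p. p \<in> A" p] by (simp add: carrier_K)
  then show ?thesis using assms(3) by (simp add: class_char_def virtual_eq_iff)
qed

lemma carrier_K_obtain:
  assumes "A \<in> carrier K"
  obtains \<rho> \<sigma> where "\<rho> \<in> reps G" "\<sigma> \<in> reps G" "(\<rho>, \<sigma>) \<in> A"
  using assms equiv_class_self[OF equiv_virtual_eq] by (auto simp: carrier_K elim!: quotientE)

lemma carrier_K_reps: "A \<in> carrier K \<Longrightarrow> (\<rho>, \<sigma>) \<in> A \<Longrightarrow> \<rho> \<in> reps G \<and> \<sigma> \<in> reps G"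
  by (auto simp: carrier_K virtual_eq_iff elim!: quotientE)

text \<open>Through this, an equation in the ring is checked by evaluating characters.\<close>

lemma class_char_inject:
  assumes "A \<in> carrier K" "B \<in> carrier K" "\<And>g. g \<in> carrier G \<Longrightarrow> class_char A g = class_char B g"
  shows "A = B"
proof -
  obtain p q where "p \<in> A" "p \<in> reps G \<times> reps G" "q \<in> B" "q \<in> reps G \<times> reps G"
    using assms(1,2) by (meson carrier_K_obtain mem_Times_iff SigmaI)
  moreover from this have "(p, q) \<in> virtual_eq G"
    using assms by (simp add: virtual_eq_iff class_char_eq)
  ultimately show ?thesis
    using assms(1,2) quotient_eq_iff[OF equiv_virtual_eq] by (simp add: carrier_K)
qed

text \<open>Sums and products of classes are defined as images of the set of all combinations of
  representatives. If these share one character, the image is a single class; \<open>p\<close>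
  ensures that it is nonempty.\<close>

lemma virtual_eq_Image:
  assumes "p \<in> S" "S \<subseteq> reps G \<times> reps G"
    and "\<And>q g. q \<in> S \<Longrightarrow> g \<in> carrier G \<Longrightarrow> vchar q g = \<chi> g"
  shows "virtual_eq G `` S \<in> carrier K" "\<And>g. g \<in> carrier G \<Longrightarrow> class_char (virtual_eq G `` S) g = \<chi> g"
proof -
  have eq: "(q, x) \<in> virtual_eq G \<longleftrightarrow> (p, x) \<in> virtual_eq G" if "q \<in> S" for q x
    using assms that by (auto simp: virtual_eq_iff)
  have *: "virtual_eq G `` S = virtual_eq G `` {p}"
  proof (rule Set.set_eqI)
    fix x
    have "x \<in> virtual_eq G `` S \<longleftrightarrow> (\<exists>q\<in>S. (p, x) \<in> virtual_eq G)"
      unfolding Image_iff by (rule bex_cong[OF refl eq])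
    also have "\<dots> \<longleftrightarrow> (p, x) \<in> virtual_eq G"
      using assms(1) by blast
    also have "\<dots> \<longleftrightarrow> x \<in> virtual_eq G `` {p}"
      by (rule Image_singleton_iff[symmetric])
    finally show "x \<in> virtual_eq G `` S \<longleftrightarrow> x \<in> virtual_eq G `` {p}" .
  qed
  show mem: "virtual_eq G `` S \<in> carrier K"
    unfolding * carrier_K using assms by (intro quotientI) auto
  have "p \<in> virtual_eq G `` S"
    unfolding * using assms equiv_class_self[OF equiv_virtual_eq] by auto
  then show "class_char (virtual_eq G `` S) g = \<chi> g" if "g \<in> carrier G" for g
    using class_char_eq[OF mem] assms that by simp
qed

section \<open>Ring operations on characters and the basis of irreducible classes\<close>

lemma
  assumes "\<rho> \<in> reps G"
  shows rep_class_carrier: "rep_class G \<rho> \<in> carrier K"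
    and class_char_rep_class: "\<And>g. g \<in> carrier G \<Longrightarrow> class_char (rep_class G \<rho>) g = mtrace (\<rho> g)"
  unfolding rep_class_def
  using virtual_eq_Image[of "(\<rho>, zero_rep)" "{(\<rho>, zero_rep)}" "\<lambda>g. mtrace (\<rho> g)"] assms zero_in_reps[of G]
  by (auto simp: vchar_def zero_rep_def mtrace_def)

lemma
  assumes A: "A \<in> carrier K" and B: "B \<in> carrier K"
  shows add_closed_K: "A \<oplus>\<^bsub>K\<^esub> B \<in> carrier K"
    and class_char_add: "\<And>g. g \<in> carrier G \<Longrightarrow> class_char (A \<oplus>\<^bsub>K\<^esub> B) g = class_char A g + class_char B g"
proof -
  let ?S = "{(dsum_rep \<rho> \<rho>', dsum_rep \<sigma> \<sigma>') | \<rho> \<sigma> \<rho>' \<sigma>'. (\<rho>, \<sigma>) \<in> A \<and> (\<rho>', \<sigma>') \<in> B}"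
  obtain \<rho> \<sigma> \<rho>' \<sigma>' where "(\<rho>, \<sigma>) \<in> A" "(\<rho>', \<sigma>') \<in> B"
    using A B by (meson carrier_K_obtain)
  then have "(dsum_rep \<rho> \<rho>', dsum_rep \<sigma> \<sigma>') \<in> ?S" by blast
  moreover have "?S \<subseteq> reps G \<times> reps G"
    using carrier_K_reps[OF A] carrier_K_reps[OF B] by (fastforce intro!: dsum_in_reps)
  moreover have "vchar q g = class_char A g + class_char B g" if "q \<in> ?S" and g: "g \<in> carrier G" for q g
  proof -
    from that obtain \<rho> \<sigma> \<rho>' \<sigma>' where q: "q = (dsum_rep \<rho> \<rho>', dsum_rep \<sigma> \<sigma>')"
      and AB: "(\<rho>, \<sigma>) \<in> A" "(\<rho>', \<sigma>') \<in> B"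
      by blast
    have cc: "class_char A g = mtrace (\<rho> g) - mtrace (\<sigma> g)" "class_char B g = mtrace (\<rho>' g) - mtrace (\<sigma>' g)"
      using class_char_eq[OF A AB(1) g] class_char_eq[OF B AB(2) g] by (simp_all add: vchar_def)
    then show ?thesis
      using carrier_K_reps[OF A AB(1)] carrier_K_reps[OF B AB(2)] g
      unfolding cc by (simp add: q vchar_def mtrace_dsum_reps)
  qed
  moreover have "A \<oplus>\<^bsub>K\<^esub> B = virtual_eq G `` ?S" by (simp add: representation_ring_def)
  ultimately show "A \<oplus>\<^bsub>K\<^esub> B \<in> carrier K"
    "\<And>g. g \<in> carrier G \<Longrightarrow> class_char (A \<oplus>\<^bsub>K\<^esub> B) g = class_char A g + class_char B g"
    by (simp_all only: virtual_eq_Image[where \<chi> = "\<lambda>g. class_char A g + class_char B g"])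
qed

lemma
  assumes A: "A \<in> carrier K" and B: "B \<in> carrier K"
  shows mult_closed_K: "A \<otimes>\<^bsub>K\<^esub> B \<in> carrier K"
    and class_char_mult: "\<And>g. g \<in> carrier G \<Longrightarrow> class_char (A \<otimes>\<^bsub>K\<^esub> B) g = class_char A g * class_char B g"
proof -
  let ?S = "{(dsum_rep (tensor_rep \<rho> \<rho>') (tensor_rep \<sigma> \<sigma>'), dsum_rep (tensor_rep \<rho> \<sigma>') (tensor_rep \<sigma> \<rho>'))
    | \<rho> \<sigma> \<rho>' \<sigma>'. (\<rho>, \<sigma>) \<in> A \<and> (\<rho>', \<sigma>') \<in> B}"
  obtain \<rho> \<sigma> \<rho>' \<sigma>' where "(\<rho>, \<sigma>) \<in> A" "(\<rho>', \<sigma>') \<in> B"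
    using A B by (meson carrier_K_obtain)
  then have "(dsum_rep (tensor_rep \<rho> \<rho>') (tensor_rep \<sigma> \<sigma>'), dsum_rep (tensor_rep \<rho> \<sigma>') (tensor_rep \<sigma> \<rho>')) \<in> ?S"
    by blast
  moreover have "?S \<subseteq> reps G \<times> reps G"
    using carrier_K_reps[OF A] carrier_K_reps[OF B] by (fastforce intro!: dsum_in_reps tensor_in_reps)
  moreover have "vchar q g = class_char A g * class_char B g" if "q \<in> ?S" and g: "g \<in> carrier G" for q g
  proof -
    from that obtain \<rho> \<sigma> \<rho>' \<sigma>' where q: "q = (dsum_rep (tensor_rep \<rho> \<rho>') (tensor_rep \<sigma> \<sigma>'), dsum_rep (tensor_rep \<rho> \<sigma>') (tensor_rep \<sigma> \<rho>'))"
      and AB: "(\<rho>, \<sigma>) \<in> A" "(\<rho>', \<sigma>') \<in> B"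
      by blast
    have cc: "class_char A g = mtrace (\<rho> g) - mtrace (\<sigma> g)" "class_char B g = mtrace (\<rho>' g) - mtrace (\<sigma>' g)"
      using class_char_eq[OF A AB(1) g] class_char_eq[OF B AB(2) g] by (simp_all add: vchar_def)
    have r: "\<rho> \<in> reps G" "\<sigma> \<in> reps G" "\<rho>' \<in> reps G" "\<sigma>' \<in> reps G"
      using carrier_K_reps[OF A AB(1)] carrier_K_reps[OF B AB(2)] by auto
    have "vchar q g = (mtrace (\<rho> g) * mtrace (\<rho>' g) + mtrace (\<sigma> g) * mtrace (\<sigma>' g)) -
        (mtrace (\<rho> g) * mtrace (\<sigma>' g) + mtrace (\<sigma> g) * mtrace (\<rho>' g))"
      by (simp only: q vchar_def fst_conv snd_conv mtrace_dsum_reps mtrace_tensor_reps tensor_in_reps r g)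
    then show ?thesis unfolding cc by (simp only: algebra_simps)
  qed
  moreover have "A \<otimes>\<^bsub>K\<^esub> B = virtual_eq G `` ?S" by (simp add: representation_ring_def)
  ultimately show "A \<otimes>\<^bsub>K\<^esub> B \<in> carrier K"
    "\<And>g. g \<in> carrier G \<Longrightarrow> class_char (A \<otimes>\<^bsub>K\<^esub> B) g = class_char A g * class_char B g"
    by (simp_all only: virtual_eq_Image[where \<chi> = "\<lambda>g. class_char A g * class_char B g"])
qed

lemma zero_K: "\<zero>\<^bsub>K\<^esub> = rep_class G zero_rep" and one_K: "\<one>\<^bsub>K\<^esub> = rep_class G trivial_rep"
  by (simp_all add: representation_ring_def)

lemma class_char_zero: "g \<in> carrier G \<Longrightarrow> class_char \<zero>\<^bsub>K\<^esub> g = 0"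
  unfolding zero_K using zero_in_reps[of G] by (simp add: class_char_rep_class) (simp add: zero_rep_def mtrace_def)

lemma class_char_one: "g \<in> carrier G \<Longrightarrow> class_char \<one>\<^bsub>K\<^esub> g = 1"
  unfolding one_K using trivial_in_reps[of G] by (simp add: class_char_rep_class) (simp add: trivial_rep_def mtrace_def)

lemma abelian_group_K: "abelian_group K"
proof (rule abelian_groupI)
  have zero: "\<zero>\<^bsub>K\<^esub> \<in> carrier K"
    unfolding zero_K using zero_in_reps by (rule rep_class_carrier)
  then show "\<zero>\<^bsub>K\<^esub> \<in> carrier K" .
  fix A assume A: "A \<in> carrier K"
  then show "\<zero>\<^bsub>K\<^esub> \<oplus>\<^bsub>K\<^esub> A = A"
    using zero by (intro class_char_inject) (simp_all add: add_closed_K class_char_add class_char_zero)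
  obtain \<rho> \<sigma> where \<rho>\<sigma>: "\<rho> \<in> reps G" "\<sigma> \<in> reps G" "(\<rho>, \<sigma>) \<in> A" using A by (rule carrier_K_obtain)
  \<comment> \<open>The additive inverse exchanges the two halves of the formal difference.\<close>
  have B: "virtual_eq G `` {(\<sigma>, \<rho>)} \<in> carrier K"
    "\<And>g. g \<in> carrier G \<Longrightarrow> class_char (virtual_eq G `` {(\<sigma>, \<rho>)}) g = vchar (\<sigma>, \<rho>) g"
    using virtual_eq_Image[of "(\<sigma>, \<rho>)" "{(\<sigma>, \<rho>)}" "vchar (\<sigma>, \<rho>)"] \<rho>\<sigma> by auto
  have "virtual_eq G `` {(\<sigma>, \<rho>)} \<oplus>\<^bsub>K\<^esub> A = \<zero>\<^bsub>K\<^esub>"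
    using A B zero \<rho>\<sigma>
    by (intro class_char_inject)
      (simp_all add: add_closed_K class_char_add class_char_zero class_char_eq[OF A \<rho>\<sigma>(3)] vchar_def)
  with B(1) show "\<exists>B\<in>carrier K. B \<oplus>\<^bsub>K\<^esub> A = \<zero>\<^bsub>K\<^esub>" by blast
next
  fix A B C assume "A \<in> carrier K" "B \<in> carrier K" "C \<in> carrier K"
  then show "A \<oplus>\<^bsub>K\<^esub> B \<oplus>\<^bsub>K\<^esub> C = A \<oplus>\<^bsub>K\<^esub> (B \<oplus>\<^bsub>K\<^esub> C)"
    by (intro class_char_inject) (simp_all add: add_closed_K class_char_add)
next
  fix A B assume "A \<in> carrier K" "B \<in> carrier K"
  then show "A \<oplus>\<^bsub>K\<^esub> B = B \<oplus>\<^bsub>K\<^esub> A"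
    by (intro class_char_inject) (simp_all add: add_closed_K class_char_add)
qed (rule add_closed_K)

lemma R_in_reps: "i \<in> I \<Longrightarrow> R i \<in> reps G"
  using rep_R by (auto simp: reps_def)

lemma inj_on_rep_class: "inj_on (\<lambda>i. rep_class G (R i)) I"
proof (rule inj_onI)
  fix i j assume ij: "i \<in> I" "j \<in> I" and eq: "rep_class G (R i) = rep_class G (R j)"
  show "i = j"
  proof (rule ccontr)
    assume "i \<noteq> j"
    \<comment> \<open>Equal classes would make the difference of two characters of the family
      vanish; its coefficient at \<open>j\<close> is -1.\<close>
    have "of_bool (j = i) - of_bool (j = j) = (0 :: complex)"
    proof (rule characters_independent[where c = "\<lambda>k. of_bool (k = i) - of_bool (k = j)", OF _ ij(2)])
      fix g assume g: "g \<in> carrier G"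
      have "mtrace (R i g) = mtrace (R j g)"
        using arg_cong[OF eq, of "\<lambda>A. class_char A g"] ij g by (simp add: class_char_rep_class R_in_reps)
      moreover have "(\<Sum>k\<in>I. of_bool (k = l) * mtrace (R k g)) = mtrace (R l g)" if "l \<in> I" for l
        using finite_I that by (simp add: of_bool_def if_distrib[of "\<lambda>x. x * _"] cong: if_cong)
      ultimately show "(\<Sum>k\<in>I. (of_bool (k = i) - of_bool (k = j)) * mtrace (R k g)) = 0"
        using ij by (simp add: left_diff_distrib sum_subtractf)
    qed
    then show False using \<open>i \<noteq> j\<close> by simp
  qed
qed

theorem z_basis_representation_ring: "z_basis K ((\<lambda>i. rep_class G (R i)) ` I)"
proof -
  let ?r = "\<lambda>i. rep_class G (R i)"
  have X: "finite (?r ` I)" "?r ` I \<subseteq> carrier K"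
    using finite_I rep_class_carrier R_in_reps by auto
  have char: "class_char (zcomb K (?r ` I) c) g = (\<Sum>i\<in>I. of_int (c (?r i)) * mtrace (R i g))"
    if g: "g \<in> carrier G" for c g
  proof -
    have "class_char (zcomb K (?r ` I) c) g = (\<Sum>x\<in>?r ` I. of_int (c x) * class_char x g)"
      by (rule additive_zcomb[OF abelian_group_K _ X]) (simp add: class_char_add g)
    then show ?thesis
      using g by (simp add: sum.reindex[OF inj_on_rep_class] class_char_rep_class R_in_reps)
  qed
  show ?thesis
    unfolding z_basis_def
  proof (intro conjI ballI X)
    fix A assume A: "A \<in> carrier K"
    obtain \<rho> \<sigma> where \<rho>\<sigma>: "\<rho> \<in> reps G" "\<sigma> \<in> reps G" "(\<rho>, \<sigma>) \<in> A" using A by (rule carrier_K_obtain)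
    obtain m where m: "\<And>g. g \<in> carrier G \<Longrightarrow> mtrace (\<rho> g) = (\<Sum>i\<in>I. of_nat (m i) * mtrace (R i g))"
      using \<rho>\<sigma>(1) character_multiplicities by (auto simp: reps_def)
    obtain n where n: "\<And>g. g \<in> carrier G \<Longrightarrow> mtrace (\<sigma> g) = (\<Sum>i\<in>I. of_nat (n i) * mtrace (R i g))"
      using \<rho>\<sigma>(2) character_multiplicities by (auto simp: reps_def)
    \<comment> \<open>Coefficients live on classes, not on \<open>I\<close>, so the multiplicities
      are transported by \<open>inv_into\<close>; the restricted lambda makes \<open>c\<close>
      extensional.\<close>
    define c where "c = (\<lambda>x\<in>?r ` I. int (m (inv_into I ?r x)) - int (n (inv_into I ?r x)))"
    have c: "c (?r i) = int (m i) - int (n i)" if "i \<in> I" for i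
      using that by (simp add: c_def inv_into_f_f[OF inj_on_rep_class])
    show "\<exists>!c. c \<in> ?r ` I \<rightarrow>\<^sub>E UNIV \<and> A = zcomb K (?r ` I) c"
    proof (rule ex1I[of _ c])
      have "A = zcomb K (?r ` I) c"
        using A zcomb_closed[OF abelian_group_K X(2)]
      proof (rule class_char_inject)
        fix g assume "g \<in> carrier G"
        then show "class_char A g = class_char (zcomb K (?r ` I) c) g"
          by (simp add: char c class_char_eq[OF A \<rho>\<sigma>(3)] vchar_def m n left_diff_distrib sum_subtractf)
      qed
      then show "c \<in> ?r ` I \<rightarrow>\<^sub>E UNIV \<and> A = zcomb K (?r ` I) c" by (simp add: c_def)
      fix c' assume c': "c' \<in> ?r ` I \<rightarrow>\<^sub>E UNIV \<and> A = zcomb K (?r ` I) c'"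
      \<comment> \<open>Two expansions of \<open>A\<close> have the same character, so their
        difference is a linear relation between characters.\<close>
      have "(of_int (c' (?r i) - c (?r i)) :: complex) = 0" if "i \<in> I" for i
      proof (rule characters_independent[OF _ that])
        fix g assume g: "g \<in> carrier G"
        have "class_char (zcomb K (?r ` I) c') g = class_char (zcomb K (?r ` I) c) g"
          using c' \<open>A = zcomb K (?r ` I) c\<close> by (metis (no_types))
        then show "(\<Sum>i\<in>I. of_int (c' (?r i) - c (?r i)) * mtrace (R i g)) = 0"
          using g by (simp add: char left_diff_distrib sum_subtractf)
      qed
      then have "c' (?r i) = c (?r i)" if "i \<in> I" for i
        using that unfolding of_int_eq_0_iff by simp
      then show "c' = c"
        using c' by (intro PiE_ext[of _ "?r ` I" "\<lambda>_. UNIV"]) (auto simp: c_def)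
    qed
  qed
qed

end

section \<open>The irreducible representations of the symmetric group on four points\<close>

text \<open>Common form of both nonlinear constructions: the action on coordinate sum zero in the
  basis of differences with the last unit vector, of size 3 for four points and size 2 for the three
  pairings.\<close>

definition deleted_perm_mat :: "nat \<Rightarrow> (nat \<Rightarrow> nat) \<Rightarrow> complex mat" where
  "deleted_perm_mat n p = mat n n (\<lambda>(i, j). of_bool (p (Suc j) = Suc i) - of_bool (p (Suc n) = Suc i))"

lemma deleted_perm_mat_carrier [simp]: "deleted_perm_mat n p \<in> carrier_mat n n"
  by (simp add: deleted_perm_mat_def)

lemma index_deleted_perm_mat:
  "i < n \<Longrightarrow> j < n \<Longrightarrow>
    deleted_perm_mat n p $$ (i, j) = of_bool (p (Suc j) = Suc i) - of_bool (p (Suc n) = Suc i)"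
  by (simp add: deleted_perm_mat_def)

lemma deleted_perm_mat_cong:
  "(\<And>k. k \<in> {1..Suc n} \<Longrightarrow> p k = q k) \<Longrightarrow> deleted_perm_mat n p = deleted_perm_mat n q"
  by (intro eq_matI) (simp_all add: deleted_perm_mat_def)

lemma deleted_perm_mat_id: "deleted_perm_mat n id = 1\<^sub>m n"
  by (intro eq_matI) (auto simp: deleted_perm_mat_def)

lemma deleted_perm_mat_compose:
  assumes "\<And>k. k \<in> {1..Suc n} \<Longrightarrow> q k \<in> {1..Suc n}"
  shows "deleted_perm_mat n (p \<circ> q) = deleted_perm_mat n p * deleted_perm_mat n q"
proof (rule eq_matI)
  fix i j assume "i < dim_row (deleted_perm_mat n p * deleted_perm_mat n q)"
    "j < dim_col (deleted_perm_mat n p * deleted_perm_mat n q)"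
  then have ij: "i < n" "j < n" using carrier_matD[OF deleted_perm_mat_carrier] by auto
  \<comment> \<open>Row \<open>i\<close> of the first matrix, continued to \<open>k = n\<close>,
    where it is zero.\<close>
  define P where "P k = (of_bool (p (Suc k) = Suc i) - of_bool (p (Suc n) = Suc i) :: complex)" for k
  have pick: "(\<Sum>k<Suc n. P k * of_bool (q m = Suc k)) = P (q m - 1)" if "m \<in> {1..Suc n}" for m
  proof -
    have "(\<Sum>k<Suc n. P k * of_bool (q m = Suc k)) = (\<Sum>k<Suc n. if k = q m - 1 then P k else 0)"
      using assms[OF that] by (intro sum.cong) auto
    also have "\<dots> = P (q m - 1)" using assms[OF that] by (subst sum.delta) auto
    finally show ?thesis .
  qed
  have "(deleted_perm_mat n p * deleted_perm_mat n q) $$ (i, j) =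
      (\<Sum>k<n. P k * (of_bool (q (Suc j) = Suc k) - of_bool (q (Suc n) = Suc k)))"
    using ij by (subst index_mult_mat_sum[of _ n n _ n]) (simp_all add: index_deleted_perm_mat P_def)
  \<comment> \<open>The extra term vanishes since \<open>P n = 0\<close>, and the longer range
    contains every value of \<open>q\<close> shifted down by one, as \<open>pick\<close>
    needs.\<close>
  also have "\<dots> = (\<Sum>k<Suc n. P k * (of_bool (q (Suc j) = Suc k) - of_bool (q (Suc n) = Suc k)))"
    by (simp add: P_def)
  also have "\<dots> = P (q (Suc j) - 1) - P (q (Suc n) - 1)"
    using ij by (simp only: right_diff_distrib sum_subtractf, subst (1 2) pick) auto
  also have "\<dots> = deleted_perm_mat n (p \<circ> q) $$ (i, j)"
    using ij assms[of "Suc j"] assms[of "Suc n"] by (simp add: index_deleted_perm_mat P_def)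
  finally show "deleted_perm_mat n (p \<circ> q) $$ (i, j) = (deleted_perm_mat n p * deleted_perm_mat n q) $$ (i, j)"
    by simp
qed (auto simp: carrier_matD[OF deleted_perm_mat_carrier])

lemma mtrace_deleted_perm_mat:
  "mtrace (deleted_perm_mat n p) = (\<Sum>i<n. of_bool (p (Suc i) = Suc i) - of_bool (p (Suc n) = Suc i))"
  by (simp add: mtrace_def index_deleted_perm_mat carrier_matD[OF deleted_perm_mat_carrier])

lemma standard_rep_eq: "standard_rep p = deleted_perm_mat 3 p"
  by (simp add: standard_rep_def deleted_perm_mat_def)

lemma two_dim_rep_eq: "two_dim_rep p = deleted_perm_mat 2 (pairing_perm p)"
  by (simp add: two_dim_rep_def deleted_perm_mat_def numeral_3_eq_3)

section \<open>The action on the three pairings of four points\<close>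

abbreviation S4 :: "(nat \<Rightarrow> nat) monoid" where "S4 \<equiv> sym_group 4"

lemma sum_S4:
  assumes "p \<in> carrier S4"
  shows "p 1 + p 2 + p 3 + p 4 = 10"
proof -
  have "(\<Sum>i\<in>{1..4}. p i) = (\<Sum>i\<in>{1..4}. i)"
    using sum.permute[of p "{1..4}" "\<lambda>i. i"] assms by (simp add: sym_group_carrier)
  also have "{1..4} = {1, 2, 3, 4::nat}" by auto
  finally show ?thesis by simp
qed

lemma S4_range: "p \<in> carrier S4 \<Longrightarrow> p k \<in> {1..4} \<longleftrightarrow> k \<in> {1..4}"
  by (simp only: sym_group_carrier permutes_in_image)

lemma S4_inj: "p \<in> carrier S4 \<Longrightarrow> p j = p k \<longleftrightarrow> j = k"
  unfolding sym_group_carrier by (metis permutes_inj injD)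

text \<open>The number of the partition containing the pair \<open>{x, y}\<close>.\<close>

definition pairing :: "nat \<Rightarrow> nat \<Rightarrow> nat" where
  "pairing x y = (if x = 4 then y else if y = 4 then x else 6 - x - y)"

lemma pairing_perm_eq: "pairing_perm p k = pairing (p k) (p 4)"
  by (simp add: pairing_perm_def pairing_def)

lemma pairing_range:
  assumes "x \<in> {1..4}" "y \<in> {1..4}" "x \<noteq> y"
  shows "pairing x y \<in> {1..3}"
  using assms by (auto simp: pairing_def)

text \<open>One of the four points is 4. If it is \<open>x\<close>, say, then
  \<open>6 - z - w = y\<close> because the total is 10, so complementary pairs receive the same
  number.\<close>

lemma pairing_complement:
  assumes "x + y + z + w = 10" "x \<in> {1..4}" "y \<in> {1..4}" "z \<in> {1..4}" "w \<in> {1..4}" "distinct [x, y, z, w]"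
  shows "pairing x y = pairing z w"
proof -
  have four: "{1..4} = {1, 2, 3, 4::nat}" by auto
  have "x \<in> {1, 2, 3, 4}" "y \<in> {1, 2, 3, 4}" "z \<in> {1, 2, 3, 4}" "w \<in> {1, 2, 3, 4}"
    using assms(2-5) by (simp_all only: four)
  then have "x = 4 \<or> y = 4 \<or> z = 4 \<or> w = 4" using assms(6) by auto
  then show ?thesis using assms by (auto simp: pairing_def)
qed

text \<open>For \<open>x\<close> and \<open>y\<close> different from 4, the number of their
  partition is the third point \<open>z\<close> of 1, 2, 3. The pairs of images \<open>p x\<close>,
  \<open>p y\<close> and \<open>p z\<close>, \<open>p 4\<close> are again complementary.\<close>

lemma pairing_S4:
  assumes p: "p \<in> carrier S4" and xy: "x \<in> {1..4}" "y \<in> {1..4}" "x \<noteq> y"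
  shows "pairing (p x) (p y) = pairing (p (pairing x y)) (p 4)"
proof (cases "x = 4 \<or> y = 4")
  case True
  then show ?thesis using xy by (auto simp: pairing_def)
next
  case False
  define z where "z = 6 - x - y"
  have z: "pairing x y = z" using False by (simp add: pairing_def z_def)
  have "x \<in> {1, 2, 3}" "y \<in> {1, 2, 3}" using False xy by auto
  then have xyz: "z \<in> {1..4}" "distinct [x, y, z, 4]" and sum: "p x + p y + p z + p 4 = 10"
    using xy sum_S4[OF p] by (auto simp: z_def)
  have "distinct [p x, p y, p z, p 4]"
    using xyz(2) by (simp add: S4_inj[OF p])
  with sum show ?thesis
    unfolding z using xy xyz(1) S4_range[OF p] by (intro pairing_complement) auto
qed

lemma pairing_perm_range:
  assumes "p \<in> carrier S4" "k \<in> {1..3}"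
  shows "pairing_perm p k \<in> {1..3}"
  unfolding pairing_perm_eq
  by (rule pairing_range) (use assms S4_range[of p] S4_inj[of p k 4] in auto)

lemma pairing_perm_compose:
  assumes "p \<in> carrier S4" "q \<in> carrier S4" "k \<in> {1..3}"
  shows "pairing_perm (p \<circ> q) k = pairing_perm p (pairing_perm q k)"
  unfolding pairing_perm_eq o_apply
  by (rule pairing_S4) (use assms S4_range[of q] S4_inj[of q k 4] in auto)

section \<open>The sign, standard and two-dimensional representations\<close>

lemma representation_sign: "representation S4 1 sign_rep"
  unfolding representation_def
proof (intro conjI ballI)
  fix p q assume "p \<in> carrier S4" "q \<in> carrier S4"
  then have "sign (p \<circ> q) = sign p * sign q"
    by (intro sign_compose sym_group_carrier')
  then show "sign_rep (p \<otimes>\<^bsub>S4\<^esub> q) = sign_rep p * sign_rep q"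
    by (intro eq_matI) (auto simp: sign_rep_def sym_group_mult scalar_prod_def)
qed (auto simp: sign_rep_def sym_group_one intro!: eq_matI)

lemma representation_standard: "representation S4 3 standard_rep"
  unfolding representation_def standard_rep_eq
proof (intro conjI ballI)
  fix p q assume "p \<in> carrier S4" "q \<in> carrier S4"
  then show "deleted_perm_mat 3 (p \<otimes>\<^bsub>S4\<^esub> q) = deleted_perm_mat 3 p * deleted_perm_mat 3 q"
    unfolding sym_group_mult by (intro deleted_perm_mat_compose) (use S4_range[of q] in auto)
qed (simp_all add: sym_group_one deleted_perm_mat_id)

lemma representation_two_dim: "representation S4 2 two_dim_rep"
  unfolding representation_def two_dim_rep_eq
proof (intro conjI ballI)
  fix p q assume pq: "p \<in> carrier S4" "q \<in> carrier S4"
  \<comment> \<open>\<open>pairing_perm\<close> is multiplicative only on 1, 2, 3, which is all that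
    the matrix of size 2 sees.\<close>
  have "deleted_perm_mat 2 (pairing_perm (p \<circ> q)) = deleted_perm_mat 2 (pairing_perm p \<circ> pairing_perm q)"
    using pairing_perm_compose[OF pq] by (intro deleted_perm_mat_cong) auto
  also have "\<dots> = deleted_perm_mat 2 (pairing_perm p) * deleted_perm_mat 2 (pairing_perm q)"
    using pairing_perm_range[OF pq(2)] by (intro deleted_perm_mat_compose) auto
  finally show "deleted_perm_mat 2 (pairing_perm (p \<otimes>\<^bsub>S4\<^esub> q)) =
      deleted_perm_mat 2 (pairing_perm p) * deleted_perm_mat 2 (pairing_perm q)"
    by (simp add: sym_group_mult)
next
  have "deleted_perm_mat 2 (pairing_perm id) = deleted_perm_mat 2 id"
    by (intro deleted_perm_mat_cong) (auto simp: pairing_perm_def)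
  then show "deleted_perm_mat 2 (pairing_perm \<one>\<^bsub>S4\<^esub>) = 1\<^sub>m 2"
    by (simp add: sym_group_one deleted_perm_mat_id)
qed simp

section \<open>Enumeration and character table of the symmetric group\<close>

lemma permutes_insert_cases:
  assumes "p permutes insert a S"
  obtains b q where "b \<in> insert a S" "q permutes S" "p = transpose a b \<circ> q"
  using assms permutes_insert[of a S] by (auto simp: set_eq_iff)

text \<open>Successively splitting off the images of 4, 3 and 2 lists the 4 * 3 * 2 = 24 elements.
  The choices \<open>b = 4\<close>, \<open>c = 3\<close>, \<open>d = 2\<close> contribute identity
  factors.\<close>

lemma S4_cases:
  assumes "p \<in> carrier S4"
  obtains b c d where "b \<in> {1, 2, 3, 4}" "c \<in> {1, 2, 3}" "d \<in> {1, 2}"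
    "p = transpose 4 b \<circ> (transpose 3 c \<circ> transpose 2 d)"
proof -
  have "{1..4} = insert 4 (insert 3 (insert 2 {1::nat}))" by auto
  then have "p permutes insert 4 (insert 3 (insert 2 {1}))"
    using assms by (simp add: sym_group_carrier)
  then obtain b q where b: "b \<in> {4, 3, 2, 1}" "q permutes {3, 2, 1}" "p = transpose 4 b \<circ> q"
    by (rule permutes_insert_cases)
  from b(2) obtain c r where c: "c \<in> {3, 2, 1}" "r permutes {2, 1}" "q = transpose 3 c \<circ> r"
    by (rule permutes_insert_cases)
  from c(2) obtain d t where d: "d \<in> {2, 1}" "t permutes {1}" "r = transpose 2 d \<circ> t"
    by (rule permutes_insert_cases)
  have "t = id" using d(2) by (simp add: permutes_sing)
  then show thesis
    using b c d by (intro that[of b c d]) auto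
qed

text \<open>The rows are the classes of the identity, the transpositions, the double transpositions,
  the 3-cycles and the 4-cycles.\<close>

lemma S4_character_table:
  assumes "p \<in> carrier S4"
  defines "s \<equiv> mtrace (sign_rep p)" and "t \<equiv> mtrace (two_dim_rep p)" and "u \<equiv> mtrace (standard_rep p)"
  shows "s = 1 \<and> t = 2 \<and> u = 3 \<and> p = id \<or> p \<noteq> id \<and>
    (s = -1 \<and> t = 0 \<and> u = 1 \<or> s = 1 \<and> t = 2 \<and> u = -1 \<or> s = 1 \<and> t = -1 \<and> u = 0 \<or> s = -1 \<and> t = 0 \<and> u = -1)"
proof -
  have L2: "{..<2} = {0, 1::nat}" and L3: "{..<3} = {0, 1, 2::nat}" by auto
  have s: "s = of_int (sign p)" by (simp add: s_def sign_rep_def mtrace_def)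
  have u: "u = of_bool (p 1 = 1) + of_bool (p 2 = 2) + of_bool (p 3 = 3)
      - of_bool (p 4 = 1) - of_bool (p 4 = 2) - of_bool (p 4 = 3)"
    by (simp add: u_def standard_rep_eq mtrace_deleted_perm_mat L3 flip: One_nat_def)
  have t: "t = of_bool (pairing_perm p 1 = 1) + of_bool (pairing_perm p 2 = 2)
      - of_bool (pairing_perm p 3 = 1) - of_bool (pairing_perm p 3 = 2)"
    by (simp add: t_def two_dim_rep_eq mtrace_deleted_perm_mat L2 flip: One_nat_def)
  \<comment> \<open>The remaining rows have \<open>u\<close> different from 3, which shows
    \<open>p \<noteq> id\<close> there.\<close>
  have id: "u = 3" if "p = id" using that by (simp add: u)
  obtain b c d where bcd: "b \<in> {1, 2, 3, 4}" "c \<in> {1, 2, 3}" "d \<in> {1, 2}"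
    and p: "p = transpose 4 b \<circ> (transpose 3 c \<circ> transpose 2 d)"
    using assms(1) by (rule S4_cases)
  have sign: "sign p = (if b = 4 then 1 else - 1) * (if c = 3 then 1 else - 1) * (if d = 2 then 1 else - 1)"
    unfolding p by (simp add: sign_compose permutation_compose permutation_swap_id sign_swap_id)
  \<comment> \<open>All 24 triples are evaluated; only \<open>(4, 3, 2)\<close> lands in the
    identity row.\<close>
  have "s = 1 \<and> t = 2 \<and> u = 3 \<and> b = 4 \<and> c = 3 \<and> d = 2 \<or>
    s = -1 \<and> t = 0 \<and> u = 1 \<or> s = 1 \<and> t = 2 \<and> u = -1 \<or> s = 1 \<and> t = -1 \<and> u = 0 \<or> s = -1 \<and> t = 0 \<and> u = -1"
    using bcd unfolding s t u sign pairing_perm_def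
    by (elim insertE emptyE; simp add: p Transposition.transpose_def)
  moreover have "p = id" if "b = 4" "c = 3" "d = 2" using that by (simp add: p)
  ultimately show ?thesis
    using id by (elim disjE conjE) auto
qed

definition S4_dim :: "nat \<Rightarrow> nat" where
  "S4_dim i = [1, 1, 2, 3, 3] ! i"

definition S4_irrep :: "nat \<Rightarrow> (nat \<Rightarrow> nat) rep" where
  "S4_irrep i = [trivial_rep, sign_rep, two_dim_rep, standard_rep, tensor_rep sign_rep standard_rep] ! i"


lemma lessThan_five: "{..<5} = {0, 1, 2, 3, 4::nat}"
  by auto

text \<open>The required identity reads \<open>1 + s + 2 t + 3 u + 3 s u\<close> in terms of the
  table: 24 in the identity row and 0 in each of the other four.\<close>

interpretation S4: regular_family S4 "{..<5}" S4_dim S4_irrep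
proof (intro regular_family.intro sym_group_is_group regular_family_axioms.intro)
  show "finite (carrier S4)"
    by (simp add: sym_group_def finite_permutations)
  show "finite {..<5::nat}" by simp
  show "0 < S4_dim i" if "i \<in> {..<5}" for i
    using that unfolding lessThan_five by (auto simp: S4_dim_def)
  show "representation S4 (S4_dim i) (S4_irrep i)" if "i \<in> {..<5}" for i
    using that representation_trivial[of S4] representation_sign representation_two_dim
      representation_standard representation_tensor[OF representation_sign representation_standard]
    unfolding lessThan_five by (auto simp: S4_dim_def S4_irrep_def)
  fix p assume p: "p \<in> carrier S4"
  have "card (carrier S4) = 24"
    by (simp add: sym_group_card_carrier fact_numeral)
  moreover have "mtrace (trivial_rep p) = 1" by (simp add: trivial_rep_def mtrace_def)
  ultimately show "(\<Sum>i<5. of_nat (S4_dim i) * mtrace (S4_irrep i p)) =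
      (if p = \<one>\<^bsub>S4\<^esub> then of_nat (card (carrier S4)) else 0)"
    using S4_character_table[OF p]
    by (auto simp: lessThan_five S4_dim_def S4_irrep_def sym_group_one
        mtrace_tensor[OF representation_sign representation_standard p])
qed

section \<open>Modules of rank one\<close>

lemma rS4_basis_eq: "rS4_basis = (\<lambda>i. rep_class S4 (S4_irrep i)) ` {..<5}"
  by (simp add: rS4_basis_def rS4_def S4.one_K V_psi_def V_rho1_def V_rho2_def V_rho3_def
      lessThan_five S4_irrep_def)

lemma z_basis_rS4: "z_basis rS4 rS4_basis"
  unfolding rS4_basis_eq rS4_def by (rule S4.z_basis_representation_ring)

lemma rS4_basis_carrier: "finite rS4_basis" "rS4_basis \<subseteq> carrier rS4"
  using z_basis_rS4 by (simp_all add: z_basis_def)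

lemma sum_rS4_basis:
  "(\<Sum>b\<in>rS4_basis. f b) = f \<one>\<^bsub>rS4\<^esub> + f V_psi + f V_rho1 + f V_rho2 + (f V_rho3 :: 'a::comm_monoid_add)"
proof -
  have "(\<Sum>b\<in>rS4_basis. f b) = (\<Sum>i<5. f (rep_class S4 (S4_irrep i)))"
    unfolding rS4_basis_eq by (simp add: sum.reindex[OF S4.inj_on_rep_class])
  then show ?thesis
    by (simp add: lessThan_five S4_irrep_def rS4_def S4.one_K V_psi_def V_rho1_def V_rho2_def V_rho3_def
        add.assoc)
qed

lemma rS4_carrier:
  "\<one>\<^bsub>rS4\<^esub> \<in> carrier rS4" "V_psi \<in> carrier rS4" "V_rho1 \<in> carrier rS4" "V_rho2 \<in> carrier rS4"
  "V_rho3 \<in> carrier rS4"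
  using rS4_basis_carrier(2) by (simp_all add: rS4_basis_def)

lemma class_char_rS4:
  assumes "p \<in> carrier S4"
  shows "class_char \<one>\<^bsub>rS4\<^esub> p = 1" "class_char V_psi p = mtrace (sign_rep p)"
    "class_char V_rho1 p = mtrace (two_dim_rep p)" "class_char V_rho2 p = mtrace (standard_rep p)"
    "class_char V_rho3 p = mtrace (sign_rep p) * mtrace (standard_rep p)"
proof -
  have "sign_rep \<in> reps S4" "two_dim_rep \<in> reps S4" "standard_rep \<in> reps S4"
    "tensor_rep sign_rep standard_rep \<in> reps S4"
    using representation_sign representation_two_dim representation_standard
      representation_tensor[OF representation_sign representation_standard]
    unfolding reps_def by blast+
  then show "class_char \<one>\<^bsub>rS4\<^esub> p = 1" "class_char V_psi p = mtrace (sign_rep p)"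
    "class_char V_rho1 p = mtrace (two_dim_rep p)" "class_char V_rho2 p = mtrace (standard_rep p)"
    "class_char V_rho3 p = mtrace (sign_rep p) * mtrace (standard_rep p)"
    using assms S4.class_char_one[OF assms]
    by (simp_all add: rS4_def V_psi_def V_rho1_def V_rho2_def V_rho3_def S4.class_char_rep_class
        mtrace_tensor[OF representation_sign representation_standard])
qed

lemmas rS4_closed = S4.add_closed_K[folded rS4_def] S4.mult_closed_K[folded rS4_def]

lemmas class_char_ops = S4.class_char_add[folded rS4_def] S4.class_char_mult[folded rS4_def]

lemmas class_char_eqI = S4.class_char_inject[folded rS4_def]

text \<open>Each relation holds in all five rows of the character table. These are the products from
  which the values of a nonnegative homomorphism to the integers are solved.\<close>

lemma rS4_products:
  "V_psi \<otimes>\<^bsub>rS4\<^esub> V_psi = \<one>\<^bsub>rS4\<^esub>"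
  "V_psi \<otimes>\<^bsub>rS4\<^esub> V_rho2 = V_rho3"
  "V_rho1 \<otimes>\<^bsub>rS4\<^esub> V_rho1 = (\<one>\<^bsub>rS4\<^esub> \<oplus>\<^bsub>rS4\<^esub> V_psi) \<oplus>\<^bsub>rS4\<^esub> V_rho1"
  "V_rho2 \<otimes>\<^bsub>rS4\<^esub> V_rho2 = ((\<one>\<^bsub>rS4\<^esub> \<oplus>\<^bsub>rS4\<^esub> V_rho1) \<oplus>\<^bsub>rS4\<^esub> V_rho2) \<oplus>\<^bsub>rS4\<^esub> V_rho3"
proof -
  have table: "mtrace (sign_rep p) * mtrace (sign_rep p) = 1"
    "mtrace (two_dim_rep p) * mtrace (two_dim_rep p) = 1 + mtrace (sign_rep p) + mtrace (two_dim_rep p)"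
    "mtrace (standard_rep p) * mtrace (standard_rep p) =
      1 + mtrace (two_dim_rep p) + mtrace (standard_rep p) + mtrace (sign_rep p) * mtrace (standard_rep p)"
    if "p \<in> carrier S4" for p
    using S4_character_table[OF that] by auto
  note simps = rS4_closed rS4_carrier class_char_ops class_char_rS4 table
  show "V_psi \<otimes>\<^bsub>rS4\<^esub> V_psi = \<one>\<^bsub>rS4\<^esub>"
    by (rule class_char_eqI) (simp_all add: simps)
  show "V_psi \<otimes>\<^bsub>rS4\<^esub> V_rho2 = V_rho3"
    by (rule class_char_eqI) (simp_all add: simps)
  show "V_rho1 \<otimes>\<^bsub>rS4\<^esub> V_rho1 = (\<one>\<^bsub>rS4\<^esub> \<oplus>\<^bsub>rS4\<^esub> V_psi) \<oplus>\<^bsub>rS4\<^esub> V_rho1"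
    by (rule class_char_eqI) (simp_all add: simps)
  show "V_rho2 \<otimes>\<^bsub>rS4\<^esub> V_rho2 = ((\<one>\<^bsub>rS4\<^esub> \<oplus>\<^bsub>rS4\<^esub> V_rho1) \<oplus>\<^bsub>rS4\<^esub> V_rho2) \<oplus>\<^bsub>rS4\<^esub> V_rho3"
    by (rule class_char_eqI) (simp_all add: simps)
qed

text \<open>The scalar by which \<open>r\<close> acts on \<open>M11\<close>, as in the definition of
  that module. It is the virtual dimension, by \<open>class_char_id\<close>.\<close>

definition rS4_dim :: "(nat \<Rightarrow> nat) virtual \<Rightarrow> int" where
  "rS4_dim r = (let c = zcoord rS4 rS4_basis r
     in c \<one>\<^bsub>rS4\<^esub> * 1 + c V_psi * 1 + c V_rho1 * 2 + c V_rho2 * 3 + c V_rho3 * 3)"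

text \<open>Expanding \<open>r\<close> in the basis leaves only the five prescribed values. It is
  used for the character at the identity and for the action on a given module, hence the general
  codomain.\<close>

lemma additive_rS4:
  fixes h :: "(nat \<Rightarrow> nat) virtual \<Rightarrow> 'b::ring_1"
  assumes add: "\<And>r s. r \<in> carrier rS4 \<Longrightarrow> s \<in> carrier rS4 \<Longrightarrow> h (r \<oplus>\<^bsub>rS4\<^esub> s) = h r + h s"
    and vals: "h \<one>\<^bsub>rS4\<^esub> = 1" "h V_psi = 1" "h V_rho1 = 2" "h V_rho2 = 3" "h V_rho3 = 3"
    and r: "r \<in> carrier rS4"
  shows "h r = of_int (rS4_dim r)"
proof -
  have "h r = h (zcomb rS4 rS4_basis (zcoord rS4 rS4_basis r))"
    by (simp add: zcomb_zcoord[OF z_basis_rS4 r])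
  also have "\<dots> = (\<Sum>b\<in>rS4_basis. of_int (zcoord rS4 rS4_basis r b) * h b)"
    using S4.abelian_group_K[folded rS4_def] add rS4_basis_carrier by (rule additive_zcomb)
  finally show ?thesis
    by (simp add: sum_rS4_basis vals rS4_dim_def Let_def)
qed

lemma class_char_id:
  assumes "r \<in> carrier rS4"
  shows "class_char r id = of_int (rS4_dim r)"
proof -
  have "id \<in> carrier S4" by (simp add: sym_group_def permutes_id)
  then show ?thesis
    using S4_character_table[of id] assms
    by (intro additive_rS4[where h = "\<lambda>r. class_char r id"]) (auto simp: class_char_ops class_char_rS4)
qed

text \<open>Multiplicativity is not visible in coordinates; it comes from evaluating characters at
  the identity and from injectivity of \<open>of_int\<close>.\<close>

lemma rS4_dim_simps:
  assumes "r \<in> carrier rS4" "s \<in> carrier rS4"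
  shows "rS4_dim (r \<oplus>\<^bsub>rS4\<^esub> s) = rS4_dim r + rS4_dim s" "rS4_dim (r \<otimes>\<^bsub>rS4\<^esub> s) = rS4_dim r * rS4_dim s"
proof -
  have id: "id \<in> carrier S4" by (simp add: sym_group_def permutes_id)
  have "(of_int (rS4_dim (r \<oplus>\<^bsub>rS4\<^esub> s)) :: complex) = of_int (rS4_dim r + rS4_dim s)"
    "(of_int (rS4_dim (r \<otimes>\<^bsub>rS4\<^esub> s)) :: complex) = of_int (rS4_dim r * rS4_dim s)"
    using assms id by (simp_all add: rS4_closed class_char_ops flip: class_char_id)
  then show "rS4_dim (r \<oplus>\<^bsub>rS4\<^esub> s) = rS4_dim r + rS4_dim s"
    "rS4_dim (r \<otimes>\<^bsub>rS4\<^esub> s) = rS4_dim r * rS4_dim s"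
    by (simp_all only: of_int_eq_iff)
qed

lemma rS4_dim_basis:
  "rS4_dim \<one>\<^bsub>rS4\<^esub> = 1" "rS4_dim V_psi = 1" "rS4_dim V_rho1 = 2" "rS4_dim V_rho2 = 3" "rS4_dim V_rho3 = 3"
proof -
  have id: "id \<in> carrier S4" by (simp add: sym_group_def permutes_id)
  have "(of_int (rS4_dim \<one>\<^bsub>rS4\<^esub>) :: complex) = of_int 1" "(of_int (rS4_dim V_psi) :: complex) = of_int 1"
    "(of_int (rS4_dim V_rho1) :: complex) = of_int 2" "(of_int (rS4_dim V_rho2) :: complex) = of_int 3"
    "(of_int (rS4_dim V_rho3) :: complex) = of_int 3"
    using S4_character_table[OF id] id rS4_carrier
    by (auto simp: class_char_rS4 simp flip: class_char_id)
  then show "rS4_dim \<one>\<^bsub>rS4\<^esub> = 1" "rS4_dim V_psi = 1" "rS4_dim V_rho1 = 2" "rS4_dim V_rho2 = 3"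
    "rS4_dim V_rho3 = 3"
    by (simp_all only: of_int_eq_iff)
qed

section \<open>The rank-one module given by the dimension\<close>

lemma M11_simps:
  "carrier M11 = UNIV" "x \<oplus>\<^bsub>M11\<^esub> y = x + y" "\<zero>\<^bsub>M11\<^esub> = 0" "r \<odot>\<^bsub>M11\<^esub> x = rS4_dim r * x"
  by (simp_all add: M11_def rS4_dim_def)

lemma abelian_group_M11: "abelian_group M11"
proof (rule abelian_groupI)
  show "\<exists>y\<in>carrier M11. y \<oplus>\<^bsub>M11\<^esub> x = \<zero>\<^bsub>M11\<^esub>" for x
    by (rule bexI[of _ "- x"]) (simp_all add: M11_simps)
qed (simp_all add: M11_simps)

lemma z_basis_M11: "z_basis M11 M11_basis" and zcoord_M11: "zcoord M11 M11_basis m 1 = m"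
proof -
  \<comment> \<open>\<open>additive_zcomb\<close> for the identity map, the group of
    \<open>M11\<close> being the integers themselves.\<close>
  have comb: "zcomb M11 {1} c = c 1" for c
    using additive_zcomb[OF abelian_group_M11, of "\<lambda>x. x" "{1}" c] by (simp add: M11_simps)
  show basis: "z_basis M11 M11_basis"
    unfolding z_basis_def M11_basis_def
  proof (intro conjI ballI)
    fix m assume "m \<in> carrier M11"
    show "\<exists>!c. c \<in> {1} \<rightarrow>\<^sub>E UNIV \<and> m = zcomb M11 {1} c"
      by (rule ex1I[of _ "\<lambda>x\<in>{1}. m"]) (auto simp: comb PiE_iff extensional_def)
  qed (simp_all add: M11_simps)
  have "m = zcomb M11 M11_basis (zcoord M11 M11_basis m)"
    by (rule zcomb_zcoord[OF basis, symmetric]) (simp add: M11_simps)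
  then show "zcoord M11 M11_basis m 1 = m"
    by (simp add: M11_basis_def comb)
qed

text \<open>The module axioms say that \<open>rS4_dim\<close> is a unital ring homomorphism. The
  predicate \<open>module\<close> also contains \<open>cring rS4\<close>, which the given module of
  the final theorem supplies.\<close>

lemma zplus_module_M11:
  assumes "cring rS4"
  shows "zplus_module rS4 rS4_basis M11 M11_basis"
  unfolding zplus_module_def
proof (intro conjI z_basis_M11 ballI)
  show "module rS4 M11"
    using assms abelian_group_M11
    by (rule moduleI) (simp_all add: M11_simps rS4_dim_simps rS4_dim_basis algebra_simps)
  fix b l k assume "b \<in> rS4_basis" "l \<in> M11_basis" "k \<in> M11_basis"
  then show "struct_const M11 M11_basis b l k \<ge> 0"
    using rS4_dim_basis unfolding rS4_basis_def M11_basis_def struct_const_def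
    by (auto simp: M11_simps zcoord_M11[unfolded M11_basis_def])
qed

theorem proposition3p1:
  fixes M :: "((nat \<Rightarrow> nat) virtual, 'm) module" and X :: "'m set"
  assumes "based_module rS4 rS4_basis M X"
    and "irreducible_zplus_module rS4 rS4_basis M X"
    and "card X = 1"
  shows "equivalent_zplus_modules rS4 rS4_basis M X M11 M11_basis"
proof -
  obtain x where X: "X = {x}" using assms(3) by (rule card_1_singletonE)
  have zplus: "zplus_module rS4 rS4_basis M {x}"
    using assms(1) by (simp add: based_module_def X)
  then have "module rS4 M" and basis: "z_basis M {x}"
    and nonneg: "\<And>b. b \<in> rS4_basis \<Longrightarrow> zcoord M {x} (b \<odot>\<^bsub>M\<^esub> x) x \<ge> 0"
    by (auto simp: zplus_module_def struct_const_def)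
  then interpret module rS4 M by simp
  have x: "x \<in> carrier M" using basis by (simp add: z_basis_def)
  \<comment> \<open>The coordinate along the single basis vector; it turns out to be the required
    isomorphism.\<close>
  define e where "e m = zcoord M {x} m x" for m
  have comb: "zcomb M {x} c = [c x] \<cdot>\<^bsub>M\<^esub> x" for c
    using x by (simp add: zcomb_def)
  have e_pow: "[e m] \<cdot>\<^bsub>M\<^esub> x = m" if "m \<in> carrier M" for m
    using zcomb_zcoord[OF basis that] unfolding comb e_def .
  have pow_e: "e ([k] \<cdot>\<^bsub>M\<^esub> x) = k" for k :: int
  proof -
    have "zcoord M {x} ([k] \<cdot>\<^bsub>M\<^esub> x) = (\<lambda>y\<in>{x}. k)"
      using basis by (rule zcoord_eqI) (simp_all add: x comb)
    then show ?thesis by (simp add: e_def)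
  qed
  have e_add: "e (m \<oplus>\<^bsub>M\<^esub> n) = e m + e n" if "m \<in> carrier M" "n \<in> carrier M" for m n
  proof -
    have "m \<oplus>\<^bsub>M\<^esub> n = [(e m + e n)] \<cdot>\<^bsub>M\<^esub> x"
      using x e_pow[OF that(1)] e_pow[OF that(2)] by (simp add: M.add.int_pow_mult)
    then show ?thesis by (simp add: pow_e)
  qed
  have e_x: "e x = 1" using pow_e[of 1] x by simp
  define \<phi> where "\<phi> r = e (r \<odot>\<^bsub>M\<^esub> x)" for r
  \<comment> \<open>Every \<open>m\<close> is the multiple \<open>[e m] \<cdot> x\<close>, so the
    action on \<open>x\<close> alone determines the scalar.\<close>
  have e_smult: "e (r \<odot>\<^bsub>M\<^esub> m) = \<phi> r * e m" if r: "r \<in> carrier rS4" and m: "m \<in> carrier M" for r m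
  proof -
    have "e (r \<odot>\<^bsub>M\<^esub> ([e m] \<cdot>\<^bsub>M\<^esub> x)) = e m * e (r \<odot>\<^bsub>M\<^esub> x)"
      using additive_add_pow_int[OF M.abelian_group_axioms, of "\<lambda>m. e (r \<odot>\<^bsub>M\<^esub> m)" x "e m"] r x
      by (simp add: smult_r_distr e_add)
    then show ?thesis by (simp add: e_pow[OF m] \<phi>_def)
  qed
  have \<phi>_add: "\<phi> (r \<oplus>\<^bsub>rS4\<^esub> s) = \<phi> r + \<phi> s" if "r \<in> carrier rS4" "s \<in> carrier rS4" for r s
    using that x by (simp add: \<phi>_def smult_l_distr e_add)
  have \<phi>_mult: "\<phi> (r \<otimes>\<^bsub>rS4\<^esub> s) = \<phi> r * \<phi> s" if "r \<in> carrier rS4" "s \<in> carrier rS4" for r s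
    using that x e_smult[of r "s \<odot>\<^bsub>M\<^esub> x"] by (simp add: \<phi>_def smult_assoc1)
  have \<phi>_one: "\<phi> \<one>\<^bsub>rS4\<^esub> = 1" using x by (simp add: \<phi>_def e_x)
  have pos: "\<phi> V_psi \<ge> 0" "\<phi> V_rho1 \<ge> 0" "\<phi> V_rho2 \<ge> 0"
    using nonneg by (simp_all add: \<phi>_def e_def rS4_basis_def)
  note closed = rS4_carrier rS4_closed
  have "\<phi> V_psi * \<phi> V_psi = 1"
    using arg_cong[OF rS4_products(1), of \<phi>] by (simp add: \<phi>_mult \<phi>_one closed)
  then have psi: "\<phi> V_psi = 1"
    using pos by (auto simp: zmult_eq_1_iff)
  have "\<phi> V_rho1 * \<phi> V_rho1 = 2 + \<phi> V_rho1"
    using arg_cong[OF rS4_products(3), of \<phi>] by (simp add: \<phi>_mult \<phi>_add \<phi>_one psi closed)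
  then have "(\<phi> V_rho1 - 2) * (\<phi> V_rho1 + 1) = 0" by (simp add: algebra_simps)
  then have rho1: "\<phi> V_rho1 = 2" using pos by auto
  \<comment> \<open>Eliminating \<open>V_rho3\<close> leaves a quadratic equation in the single
    unknown \<open>\<phi> V_rho2\<close>.\<close>
  have rho3: "\<phi> V_rho3 = \<phi> V_rho2"
    using arg_cong[OF rS4_products(2), of \<phi>] by (simp add: \<phi>_mult psi closed)
  have "\<phi> V_rho2 * \<phi> V_rho2 = 3 + 2 * \<phi> V_rho2"
    using arg_cong[OF rS4_products(4), of \<phi>] by (simp add: \<phi>_mult \<phi>_add \<phi>_one rho1 rho3 closed)
  then have "(\<phi> V_rho2 - 3) * (\<phi> V_rho2 + 1) = 0" by (simp add: algebra_simps)
  then have rho2: "\<phi> V_rho2 = 3" using pos by auto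
  \<comment> \<open>Additivity spreads the five values to the whole ring, so \<open>e\<close> will
    respect the action of every scalar.\<close>
  have \<phi>: "\<phi> r = rS4_dim r" if "r \<in> carrier rS4" for r
    using additive_rS4[of \<phi> r] \<phi>_add \<phi>_one psi rho1 rho2 rho3 that by simp
  have "bij_betw e (carrier M) (carrier M11)"
    by (rule bij_betwI[where g = "\<lambda>k. [k] \<cdot>\<^bsub>M\<^esub> x"]) (use x in \<open>auto simp: M11_simps e_pow pow_e\<close>)
  moreover have "bij_betw e {x} M11_basis"
    by (simp add: bij_betw_def M11_basis_def e_x)
  moreover have "zplus_module rS4 rS4_basis M11 M11_basis"
    by (rule zplus_module_M11) (rule R.cring_axioms)
  ultimately show ?thesis
    using zplus unfolding equivalent_zplus_modules_def X
    by (intro conjI exI[of _ e]) (auto simp: M11_simps e_add e_smult \<phi>)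
qed

end
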